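(* Let $k\ge 1$ be an integer. Let $d=d(n)>0$ and $\lambda=\lambda(n)>0$ be functions of $n$ and suppose that $\Gamma=\Gamma_n$ is an $(n,d,\lambda)$-graph satisfying $$\lambda^{2k-1}\ll \frac{d^{2k}}{n}\,(\log n)^{-2(k-1)(2k-1)} .$$ Then $$\mathrm{ex}(\Gamma,C_{2k+1})=\left(\frac12+o(1)\right)\frac{dn}{2},$$ where $o(1)$ denotes a quantity tending to $0$ as $n\to\infty$.
   Context: All graphs are finite and simple. For graphs $G$ and $F$, the generalized Turán number $\mathrm{ex}(G,F)$ is the maximum number of edges in a subgraph of $G$ that contains no copy of $F$ as a (not necessarily induced) subgraph. $C_{2k+1}$ denotes the cycle of length $2k+1$. For an $n$-vertex graph $G$ let $\lambda_1\ge\lambda_2\ge\dots\ge\lambda_n$ be the eigenvalues of its adjacency matrix, and let $\lambda(G)=\max\{\lambda_2,|\lambda_n|\}$. An $(n,d,\lambda)$-graph is a $d$-regular graph $G$ on $n$ vertices with $|\lambda(G)|\le\lambda$. For functions $f(n),g(n)>0$, $f(n)\ll g(n)$ means $f(n)/g(n)\to0$ as $n\to\infty$. The parameters $d$ and $\lambda$ may depend on $n$, and the statement concerns a sequence of graphs with $n\to\infty$. *)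

theory Defs
  imports Complex_Main "Jordan_Normal_Form.Char_Poly"
begin

type_synonym 'a graph = "'a set \<times> 'a set set"

definition verts :: "'a graph \<Rightarrow> 'a set" where
  "verts G = fst G"

definition edges :: "'a graph \<Rightarrow> 'a set set" where
  "edges G = snd G"

definition simple_graph :: "'a graph \<Rightarrow> bool" where
  "simple_graph G \<longleftrightarrow>
     finite (verts G) \<and> (\<forall>e\<in>edges G. e \<subseteq> verts G \<and> card e = 2)"

definition subgraph_of :: "'a graph \<Rightarrow> 'a graph \<Rightarrow> bool" where
  "subgraph_of H G \<longleftrightarrow>
     simple_graph H \<and> verts H \<subseteq> verts G \<and> edges H \<subseteq> edges G"

definition contains_copy :: "'a graph \<Rightarrow> 'b graph \<Rightarrow> bool" where
  "contains_copy H F \<longleftrightarrow>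
     (\<exists>f. inj_on f (verts F) \<and> f ` verts F \<subseteq> verts H \<and> (\<forall>e\<in>edges F. f ` e \<in> edges H))"

(* The set is finite for a finite graph G; it is nonempty as soon as F has a vertex, since it
   then contains the size of the empty subgraph. *)
definition ex_num :: "'a graph \<Rightarrow> 'b graph \<Rightarrow> nat" where
  "ex_num G F = Max {card (edges H) | H. subgraph_of H G \<and> \<not> contains_copy H F}"

(* A cycle only for l \<ge> 3. *)
definition cycle_graph :: "nat \<Rightarrow> nat graph" where
  "cycle_graph l = ({..<l}, {{i, Suc i mod l} | i. i < l})"

definition degree_in :: "'a graph \<Rightarrow> 'a \<Rightarrow> nat" where
  "degree_in G v = card {e \<in> edges G. v \<in> e}"

definition regular_graph :: "'a graph \<Rightarrow> nat \<Rightarrow> bool" where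
  "regular_graph G d \<longleftrightarrow> (\<forall>v\<in>verts G. degree_in G v = d)"

(* The choice of enumeration is immaterial for the spectrum: another one conjugates
   the adjacency matrix by a permutation matrix. *)
definition vertex_list :: "'a graph \<Rightarrow> 'a list" where
  "vertex_list G = (SOME xs. distinct xs \<and> set xs = verts G)"

definition adj_matrix :: "'a graph \<Rightarrow> real mat" where
  "adj_matrix G =
     mat (card (verts G)) (card (verts G))
       (\<lambda>(i, j). if {vertex_list G ! i, vertex_list G ! j} \<in> edges G then 1 else 0)"

(* Roots of the characteristic polynomial with algebraic multiplicity, in decreasing order.
   The adjacency matrix is real symmetric, so all its eigenvalues are real and the list
   has one entry per vertex. *)
definition eigenvalue_list :: "'a graph \<Rightarrow> real list" where
  "eigenvalue_list G = rev (sorted_list_of_multiset (proots (char_poly (adj_matrix G))))"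

(* Indexed from 1. *)
definition graph_eigenvalue :: "'a graph \<Rightarrow> nat \<Rightarrow> real" where
  "graph_eigenvalue G i = eigenvalue_list G ! (i - 1)"

(* Meaningful for graphs with at least two vertices. *)
definition second_eigenvalue :: "'a graph \<Rightarrow> real" where
  "second_eigenvalue G =
     max (graph_eigenvalue G 2) \<bar>graph_eigenvalue G (card (verts G))\<bar>"

definition ndl_graph :: "nat \<Rightarrow> nat \<Rightarrow> real \<Rightarrow> 'a graph \<Rightarrow> bool" where
  "ndl_graph n d l G \<longleftrightarrow>
     simple_graph G \<and> card (verts G) = n \<and> regular_graph G d \<and> \<bar>second_eigenvalue G\<bar> \<le> l"

definition much_less :: "(nat \<Rightarrow> real) \<Rightarrow> (nat \<Rightarrow> real) \<Rightarrow> bool" (infix "\<lless>" 50) where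
  "f \<lless> g \<longleftrightarrow> (\<lambda>i. f i / g i) \<longlonglongrightarrow> 0"

end

theory Submission
  imports Defs "Jordan_Normal_Form.Spectral_Radius" "HOL-Analysis.Convex"
begin

text \<open>
  Let $A$ be the adjacency matrix of $\<Gamma>$, let $J$ be the all-ones matrix and put
  $E = A - (d/n) J$. As $A$ is symmetric with constant row sums $d$, the matrix $E$ has operator
  norm at most $\<lambda>$.

  The lower bound holds because a largest cut of $\<Gamma>$ is bipartite and has at least half of
  the edges (\<open>max_cut\<close>). The upper bound is a trace form of Mantel's argument. Let
  $B \<le> A$ be the adjacency matrix of a subgraph $H$ without a cycle of length $2k+1$. All
  entries of $B$ and of $A - B$ are nonnegative, so
  \[ 0 \<le> \mathrm{tr}(B^{2k-1} (A-B)^2)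
       = \mathrm{tr}(B^{2k-1} A^2) - 2\,\mathrm{tr}(B^{2k} A) + \mathrm{tr}(B^{2k+1}). \]
  In the first two traces $A$ may be replaced by $(d/n) J$ at a cost of order
  $\<lambda>\,\mathrm{tr}(A^{2k})$. With the moments $m_i = 1^T B^i 1$ this becomes
  (\<open>walk_inequality\<close>)
  \[ 2 \frac dn m_{2k} \<le> \frac{d^2}n m_{2k-1} + 3 \<lambda>\,\mathrm{tr}(A^{2k})
       + \mathrm{tr}(B^{2k+1}). \]
  The even moments of a symmetric matrix are log-convex, so $m_{2k} \<ge> (m_1/n)\, m_{2k-1}$, and if the
  last two terms are negligible the average degree $m_1/n$ of $H$ is at most about $d/2$
  (\<open>density_bound\<close>).

  Both error terms are controlled by closed walks in $\<Gamma>$: the number of those of length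
  $p \<ge> 2$ at a given vertex is at most $d^p/n + \<lambda>^{p-2} d$
  (\<open>closed_walks_at\<close>). This gives
  $\<lambda>\,\mathrm{tr}(A^{2k}) \<le> \<lambda> d^{2k} + \<lambda>^{2k-1} n d$, which is $o(d^{2k+1})$
  exactly when $\<lambda> \<ll> d$ and $\<lambda>^{2k-1} \<ll> d^{2k}/n$. The trace of $B^{2k+1}$
  counts closed walks of length $2k+1$ in $H$; as $H$ has no cycle of this length, each of them
  repeats a vertex and splits there into two shorter closed walks, and these are again rare
  (\<open>sum_nondistinct_cycle_weight\<close>, \<open>closed_walk_product_bound\<close>).
\<close>

section \<open>Kernels acting on functions on a finite set\<close>

text \<open>
  Matrices indexed by a finite set of vertices of an arbitrary type are represented as functions of
  two vertices, acting on functions of one vertex. A matrix power is an iterate of this action, so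
  that associativity and distributivity need no side conditions on dimensions.
\<close>

definition act :: "'v set \<Rightarrow> ('v \<Rightarrow> 'v \<Rightarrow> real) \<Rightarrow> ('v \<Rightarrow> real) \<Rightarrow> 'v \<Rightarrow> real" where
  "act V M f x = (\<Sum>y\<in>V. M x y * f y)"

definition inner_on :: "'v set \<Rightarrow> ('v \<Rightarrow> real) \<Rightarrow> ('v \<Rightarrow> real) \<Rightarrow> real" where
  "inner_on V f g = (\<Sum>x\<in>V. f x * g x)"

definition point_mass :: "'v \<Rightarrow> 'v \<Rightarrow> real" where
  "point_mass y x = (if x = y then 1 else 0)"

lemma inner_on_commute: "inner_on V f g = inner_on V g f"
  by (simp add: inner_on_def mult.commute)

lemma inner_on_nonneg: "inner_on V f f \<ge> 0"
  by (simp add: inner_on_def sum_nonneg)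

lemma inner_on_diff: "inner_on V (\<lambda>x. f x - g x) h = inner_on V f h - inner_on V g h"
  and inner_on_diff_right: "inner_on V h (\<lambda>x. f x - g x) = inner_on V h f - inner_on V h g"
  by (simp_all add: inner_on_def sum_subtractf algebra_simps)

lemma act_cong: "(\<And>x. x \<in> V \<Longrightarrow> f x = g x) \<Longrightarrow> act V M f = act V M g"
  by (simp add: act_def fun_eq_iff)

lemma act_add: "act V M (\<lambda>x. f x + g x) = (\<lambda>x. act V M f x + act V M g x)"
  and act_scale: "act V M (\<lambda>x. c * f x) = (\<lambda>x. c * act V M f x)"
  by (simp_all add: act_def fun_eq_iff sum.distrib algebra_simps sum_distrib_left)

lemma act_kernel_diff: "act V (\<lambda>x y. M x y - N x y) f x = act V M f x - act V N f x"
  by (simp add: act_def sum_subtractf algebra_simps)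

lemma act_nonneg:
  "(\<And>x y. M x y \<ge> 0) \<Longrightarrow> (\<And>x. f x \<ge> 0) \<Longrightarrow> act V M f x \<ge> 0"
  by (simp add: act_def sum_nonneg)

lemma act_mono:
  "(\<And>x y. 0 \<le> M x y \<and> M x y \<le> N x y) \<Longrightarrow> (\<And>x. 0 \<le> f x \<and> f x \<le> g x)
   \<Longrightarrow> act V M f x \<le> act V N g x"
  unfolding act_def by (intro sum_mono mult_mono) (auto intro: order_trans)

lemma act_power_nonneg:
  "(\<And>x y. M x y \<ge> 0) \<Longrightarrow> (\<And>x. f x \<ge> 0) \<Longrightarrow> (act V M ^^ k) f x \<ge> 0"
  by (induction k arbitrary: x) (auto intro!: act_nonneg)

lemma act_power_mono:
  assumes "\<And>x y. 0 \<le> M x y \<and> M x y \<le> N x y" "\<And>x. f x \<ge> 0"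
  shows "(act V M ^^ k) f x \<le> (act V N ^^ k) f x"
proof (induction k arbitrary: x)
  case (Suc k)
  then show ?case using assms by (auto intro!: act_mono act_power_nonneg)
qed simp

lemma point_mass_nonneg: "point_mass y x \<ge> 0"
  by (simp add: point_mass_def)

lemma inner_on_point_mass: "finite V \<Longrightarrow> x \<in> V \<Longrightarrow> inner_on V (point_mass x) f = f x"
  by (simp add: inner_on_def point_mass_def if_distrib[of "\<lambda>u. u * _"] cong: if_cong)

lemma act_point_mass: "finite V \<Longrightarrow> y \<in> V \<Longrightarrow> act V M (point_mass y) x = M x y"
  by (simp add: act_def point_mass_def if_distrib[of "\<lambda>u. _ * u"] cong: if_cong)

lemma cauchy_schwarz_inner_on: "(inner_on V f g)\<^sup>2 \<le> inner_on V f f * inner_on V g g"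
  using Cauchy_Schwarz_ineq_sum[of f g V] by (simp add: inner_on_def power2_eq_square)

lemma act_symmetric:
  assumes "\<And>x y. M x y = M y x"
  shows "inner_on V (act V M f) g = inner_on V f (act V M g)"
proof -
  have "inner_on V (act V M f) g = (\<Sum>x\<in>V. \<Sum>y\<in>V. M x y * f y * g x)"
    by (simp add: inner_on_def act_def sum_distrib_right)
  also have "\<dots> = (\<Sum>y\<in>V. \<Sum>x\<in>V. M x y * f y * g x)"
    by (rule sum.swap)
  also have "\<dots> = inner_on V f (act V M g)"
    unfolding inner_on_def act_def sum_distrib_left
    by (intro sum.cong refl) (simp add: assms mult.commute mult.left_commute)
  finally show ?thesis .
qed

lemma act_power_symmetric:
  assumes "\<And>x y. M x y = M y x"
  shows "inner_on V ((act V M ^^ k) f) g = inner_on V f ((act V M ^^ k) g)"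
proof (induction k arbitrary: f)
  case (Suc k)
  then show ?case
    by (simp add: funpow_swap1 act_symmetric[of M, OF assms])
qed simp

lemma funpow_shift: "(T ^^ j) (T f) = (T ^^ Suc j) f"
  by (simp add: funpow_swap1)

text \<open>
  The identity $\langle P, Q \rangle = \langle P^T, Q^T \rangle$ for the Frobenius inner product,
  whose columns are the images of the point masses. Combined with moving a symmetric factor from
  one argument to the other it replaces the cyclic invariance of the trace.
\<close>

lemma sum_inner_on_point_mass_adjoint:
  assumes fin: "finite V"
    and P: "\<And>f g. inner_on V (P f) g = inner_on V f (P' g)"
    and Q: "\<And>f g. inner_on V (Q f) g = inner_on V f (Q' g)"
  shows "(\<Sum>x\<in>V. inner_on V (P (point_mass x)) (Q (point_mass x))) = (\<Sum>x\<in>V. inner_on V (P' (point_mass x)) (Q' (point_mass x)))"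
proof -
  have at: "P (point_mass x) y = P' (point_mass y) x" "Q (point_mass x) y = Q' (point_mass y) x"
    if "x \<in> V" "y \<in> V" for x y
  proof -
    have "P (point_mass x) y = inner_on V (P (point_mass x)) (point_mass y)"
      using that fin by (simp add: inner_on_commute[of V "P _"] inner_on_point_mass)
    also have "\<dots> = P' (point_mass y) x" using that fin by (simp add: P inner_on_point_mass)
    finally show "P (point_mass x) y = P' (point_mass y) x" .
    have "Q (point_mass x) y = inner_on V (Q (point_mass x)) (point_mass y)"
      using that fin by (simp add: inner_on_commute[of V "Q _"] inner_on_point_mass)
    also have "\<dots> = Q' (point_mass y) x" using that fin by (simp add: Q inner_on_point_mass)
    finally show "Q (point_mass x) y = Q' (point_mass y) x" .
  qed
  have "(\<Sum>x\<in>V. inner_on V (P (point_mass x)) (Q (point_mass x)))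
        = (\<Sum>x\<in>V. \<Sum>y\<in>V. P' (point_mass y) x * Q' (point_mass y) x)"
    unfolding inner_on_def by (intro sum.cong refl) (simp add: at)
  also have "\<dots> = (\<Sum>y\<in>V. \<Sum>x\<in>V. P' (point_mass y) x * Q' (point_mass y) x)"
    by (rule sum.swap)
  finally show ?thesis by (simp add: inner_on_def)
qed

section \<open>Log-convexity of the moments of a symmetric kernel\<close>

text \<open>
  Successive quotients of a log-convex sequence increase. The form without division remains true
  when the sequence reaches zero.
\<close>

lemma log_convex_ratio:
  fixes a :: "nat \<Rightarrow> real"
  assumes nn: "\<And>j. a j \<ge> 0" and lc: "\<And>j. (a (Suc j))\<^sup>2 \<le> a j * a (Suc (Suc j))"
    and c: "c * a 0 \<le> a 1"
  shows "c * a j \<le> a (Suc j)"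
proof (induction j)
  case 0
  then show ?case using c by simp
next
  case (Suc j)
  show ?case
  proof (cases "a (Suc j) = 0")
    case True
    then show ?thesis using nn by simp
  next
    case False
    then have pos: "a (Suc j) > 0" using nn[of "Suc j"] by simp
    have "a j \<noteq> 0"
    proof
      assume "a j = 0"
      then have "(a (Suc j))\<^sup>2 \<le> 0" using lc[of j] by simp
      then show False using pos by simp
    qed
    then have pos': "a j > 0" using nn[of j] by simp
    have "a j * (c * a (Suc j)) = (c * a j) * a (Suc j)" by simp
    also have "\<dots> \<le> a (Suc j) * a (Suc j)"
      by (rule mult_right_mono[OF Suc.IH nn])
    also have "\<dots> \<le> a j * a (Suc (Suc j))" using lc[of j] by (simp add: power2_eq_square)
    finally show ?thesis using pos' by simp
  qed
qed

lemma log_convex_growth: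
  fixes a :: "nat \<Rightarrow> real"
  assumes nn: "\<And>j. a j \<ge> 0" and lc: "\<And>j. (a (Suc j))\<^sup>2 \<le> a j * a (Suc (Suc j))"
    and c: "c * a 0 \<le> a 1" and c0: "c \<ge> 0"
  shows "c ^ j * a 0 \<le> a j"
proof (induction j)
  case (Suc j)
  have "c ^ Suc j * a 0 = c * (c ^ j * a 0)" by simp
  also have "\<dots> \<le> c * a j" by (rule mult_left_mono[OF Suc c0])
  also have "\<dots> \<le> a (Suc j)" by (rule log_convex_ratio[of a, OF nn lc c])
  finally show ?case .
qed simp

text \<open>
  Cauchy--Schwarz, after moving one factor $M$ across the inner product:
  $\|M^{j+1} f\|^2 = \langle M^j f, M^{j+2} f \rangle$.
\<close>

lemma moment_log_convex:
  fixes V :: "'v set" and f :: "'v \<Rightarrow> real"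
  assumes sym: "\<And>x y. M x y = M y x"
  defines "a \<equiv> (\<lambda>j. inner_on V ((act V M ^^ j) f) ((act V M ^^ j) f))"
  shows "(a (Suc j))\<^sup>2 \<le> a j * a (Suc (Suc j))"
proof -
  have "a (Suc j) = inner_on V ((act V M ^^ j) f) ((act V M ^^ Suc (Suc j)) f)"
    unfolding a_def by (simp add: act_symmetric[of M, OF sym])
  then show ?thesis
    unfolding a_def using cauchy_schwarz_inner_on by metis
qed


section \<open>Regular kernels with a spectral gap\<close>

definition mean_free :: "'v set \<Rightarrow> real \<Rightarrow> ('v \<Rightarrow> 'v \<Rightarrow> real) \<Rightarrow> 'v \<Rightarrow> 'v \<Rightarrow> real" where
  "mean_free V d A x y = A x y - d / real (card V)"

text \<open>
  What the counting arguments use of an $(n,d,\<lambda>)$-graph: the assumption \<open>gap\<close> says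
  that $A - (d/n) J$ has operator norm at most $\<lambda>$.
\<close>

locale pseudorandom =
  fixes V :: "'v set" and A :: "'v \<Rightarrow> 'v \<Rightarrow> real" and d lam :: real
  assumes fin: "finite V"
    and nonempty: "V \<noteq> {}"
    and sym: "A x y = A y x"
    and zero_one: "A x y \<in> {0, 1}"
    and regular: "x \<in> V \<Longrightarrow> (\<Sum>y\<in>V. A x y) = d"
    and d_pos: "d > 0" and lam_pos: "lam > 0"
    and gap: "inner_on V (act V (mean_free V d A) f) (act V (mean_free V d A) f) \<le> lam\<^sup>2 * inner_on V f f"
begin

abbreviation "n \<equiv> real (card V)"
abbreviation "E \<equiv> mean_free V d A"

lemma n_pos: "n > 0"
  using fin nonempty by (simp add: card_gt_0_iff)

lemma A_nonneg: "A x y \<ge> 0"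
  using zero_one[of x y] by auto

lemma E_sym: "E x y = E y x"
  by (simp add: mean_free_def sym)

lemma act_split: "act V A f x = d / n * sum f V + act V E f x"
  by (simp add: act_def mean_free_def left_diff_distrib sum_subtractf sum_distrib_left)

lemma sum_act_E: "(\<Sum>x\<in>V. act V E f x) = 0"
proof -
  have "(\<Sum>x\<in>V. act V E f x) = inner_on V (act V E f) (\<lambda>_. 1)" by (simp add: inner_on_def)
  also have "\<dots> = inner_on V f (act V E (\<lambda>_. 1))" by (rule act_symmetric) (rule E_sym)
  also have "\<dots> = 0"
    using n_pos by (simp add: inner_on_def act_def mean_free_def sum_subtractf regular)
  finally show ?thesis .
qed

text \<open>
  The images of $J$ are constant functions and those of $E$ have sum zero, so the mixed terms
  vanish.
\<close>

lemma inner_on_act_act: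
  "inner_on V (act V A f) (act V A g) = d\<^sup>2 / n * sum f V * sum g V + inner_on V (act V E f) (act V E g)"
proof -
  define a where "a = d / n * sum f V"
  define b where "b = d / n * sum g V"
  have "inner_on V (act V A f) (act V A g)
        = (\<Sum>x\<in>V. a * b + a * act V E g x + b * act V E f x + act V E f x * act V E g x)"
    unfolding inner_on_def act_split[of f] act_split[of g] a_def[symmetric] b_def[symmetric]
    by (simp add: algebra_simps)
  also have "\<dots> = n * (a * b) + inner_on V (act V E f) (act V E g)"
    by (simp add: sum.distrib inner_on_def sum_distrib_left[symmetric] sum_act_E)
  also have "n * (a * b) = d\<^sup>2 / n * sum f V * sum g V"
    using n_pos by (simp add: a_def b_def field_simps power2_eq_square)
  finally show ?thesis .
qed

lemma inner_on_act_split: "inner_on V f (act V A g) = d / n * sum f V * sum g V + inner_on V f (act V E g)"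
proof -
  have "inner_on V f (act V A g) = (\<Sum>x\<in>V. f x * (d / n * sum g V)) + inner_on V f (act V E g)"
    unfolding inner_on_def act_split[of g] by (simp only: distrib_left sum.distrib)
  then show ?thesis by (simp only: sum_distrib_right[symmetric] mult.assoc mult.left_commute mult.commute)
qed

lemma norm_E_le_norm_A: "inner_on V (act V E f) (act V E f) \<le> inner_on V (act V A f) (act V A f)"
  using n_pos d_pos zero_le_power2[of "sum f V"]
  by (simp add: inner_on_act_act[of f f] mult.assoc power2_eq_square[of "sum f V", symmetric])

lemma inner_on_le_of_norms:
  assumes "inner_on V f f \<le> a\<^sup>2 * inner_on V h h" "inner_on V g g \<le> b\<^sup>2 * inner_on V h h" "a \<ge> 0" "b \<ge> 0"
  shows "\<bar>inner_on V f g\<bar> \<le> a * b * inner_on V h h"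
proof (rule abs_le_square_iff[THEN iffD2, of _ "a * b * inner_on V h h", simplified, THEN order_trans])
  have "(inner_on V f g)\<^sup>2 \<le> inner_on V f f * inner_on V g g" by (rule cauchy_schwarz_inner_on)
  also have "\<dots> \<le> (a\<^sup>2 * inner_on V h h) * (b\<^sup>2 * inner_on V h h)"
    using assms inner_on_nonneg by (intro mult_mono) auto
  also have "\<dots> = (a * b * inner_on V h h)\<^sup>2" by (simp add: power2_eq_square algebra_simps)
  finally show "(inner_on V f g)\<^sup>2 \<le> (a * b * inner_on V h h)\<^sup>2" .
  show "\<bar>a * b * inner_on V h h\<bar> \<le> a * b * inner_on V h h" using assms inner_on_nonneg[of V h] by simp
qed

lemma E_form_bound: "\<bar>inner_on V f (act V E f)\<bar> \<le> lam * inner_on V f f"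
  using inner_on_le_of_norms[of f 1 f "act V E f" lam] gap[of f] lam_pos by simp

text \<open>
  Bounding one factor by $A$ and only the other by the spectral gap is what makes a single power of
  $\<lambda>$ appear, so that the error in \<open>walk_inequality\<close> has the same order for both of the
  approximated traces. The arithmetic mean makes the bound additive over the vertices.
\<close>

lemma E_form_bound2:
  "\<bar>inner_on V (act V E f) (act V E g)\<bar> \<le> lam / 2 * (inner_on V (act V A f) (act V A f) + inner_on V g g)"
proof -
  let ?a = "inner_on V (act V A f) (act V A f)" and ?b = "inner_on V g g"
  have "(inner_on V (act V E f) (act V E g))\<^sup>2
        \<le> inner_on V (act V E f) (act V E f) * inner_on V (act V E g) (act V E g)"
    by (rule cauchy_schwarz_inner_on)
  also have "\<dots> \<le> ?a * (lam\<^sup>2 * ?b)"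
    using norm_E_le_norm_A gap inner_on_nonneg by (intro mult_mono) auto
  also have "\<dots> \<le> (lam / 2 * (?a + ?b))\<^sup>2"
  proof -
    have "(lam / 2 * (?a + ?b))\<^sup>2 - ?a * (lam\<^sup>2 * ?b) = (lam / 2 * (?a - ?b))\<^sup>2"
      by (simp add: power2_eq_square algebra_simps)
    then show ?thesis using zero_le_power2[of "lam / 2 * (?a - ?b)"] by linarith
  qed
  finally have "\<bar>inner_on V (act V E f) (act V E g)\<bar> \<le> \<bar>lam / 2 * (?a + ?b)\<bar>"
    by (simp only: abs_le_square_iff)
  also have "\<dots> = lam / 2 * (?a + ?b)" using lam_pos inner_on_nonneg[of V g] inner_on_nonneg[of V "act V A f"] by simp
  finally show ?thesis .
qed

lemma E_power_norm:
  "inner_on V ((act V E ^^ j) f) ((act V E ^^ j) f) \<le> (lam ^ j)\<^sup>2 * inner_on V f f"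
proof (induction j)
  case (Suc j)
  have "inner_on V ((act V E ^^ Suc j) f) ((act V E ^^ Suc j) f)
        \<le> lam\<^sup>2 * inner_on V ((act V E ^^ j) f) ((act V E ^^ j) f)"
    using gap by simp
  also have "\<dots> \<le> lam\<^sup>2 * ((lam ^ j)\<^sup>2 * inner_on V f f)" by (intro mult_left_mono Suc) simp
  finally show ?case by (simp add: power_mult_distrib algebra_simps)
qed simp

lemma norm_act_point_mass: "v \<in> V \<Longrightarrow> inner_on V (act V A (point_mass v)) (act V A (point_mass v)) = d"
proof -
  assume v: "v \<in> V"
  have "A x v * A x v = A v x" for x using zero_one[of x v] sym[of x v] by auto
  then show ?thesis using v by (simp add: inner_on_def act_point_mass fin regular)
qed

lemma norm_E_point_mass: "v \<in> V \<Longrightarrow> inner_on V (act V E (point_mass v)) (act V E (point_mass v)) = d - d\<^sup>2 / n"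
proof -
  assume v: "v \<in> V"
  have "sum (point_mass v) V = 1" using v fin by (simp add: point_mass_def)
  then show ?thesis using inner_on_act_act[of "point_mass v" "point_mass v"] norm_act_point_mass[OF v] by simp
qed

text \<open>
  The trace of $E^2$ is $nd - d^2$, so $\<lambda>$ cannot be much smaller than $\sqrt d$ unless the
  graph is dense.
\<close>

lemma lam_lower: "d - d\<^sup>2 / n \<le> lam\<^sup>2"
proof -
  obtain v where v: "v \<in> V" using nonempty by auto
  have "inner_on V (point_mass v) (point_mass v) = 1" using v fin by (simp add: inner_on_point_mass point_mass_def)
  then show ?thesis using gap[of "point_mass v"] norm_E_point_mass[OF v] by simp
qed

text \<open>
  As $J E = E J = 0$, the powers of $A = (d/n) J + E$ have no mixed terms.
\<close>

lemma act_power_point_mass: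
  assumes "v \<in> V" "x \<in> V"
  shows "(act V A ^^ Suc p) (point_mass v) x = d ^ Suc p / n + (act V E ^^ Suc p) (point_mass v) x"
  using assms(2)
proof (induction p arbitrary: x)
  case 0
  have "sum (point_mass v) V = 1" using assms fin by (simp add: point_mass_def)
  then show ?case by (simp add: act_split[of "point_mass v"])
next
  case (Suc p)
  have "(act V A ^^ Suc (Suc p)) (point_mass v) x
        = act V A (\<lambda>y. d ^ Suc p / n * 1 + (act V E ^^ Suc p) (point_mass v) y) x"
    using act_cong[of V "(act V A ^^ Suc p) (point_mass v)"
      "\<lambda>y. d ^ Suc p / n * 1 + (act V E ^^ Suc p) (point_mass v) y"] Suc.IH by simp
  also have "\<dots> = d ^ Suc p / n * act V A (\<lambda>_. 1) x + act V A ((act V E ^^ Suc p) (point_mass v)) x"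
    by (simp only: act_add act_scale)
  also have "act V A (\<lambda>_. 1) x = d" using Suc.prems by (simp add: act_def regular)
  also have "act V A ((act V E ^^ Suc p) (point_mass v)) x = (act V E ^^ Suc (Suc p)) (point_mass v) x"
    by (simp add: act_split[of "act V E _"] sum_act_E)
  finally show ?case by simp
qed

text \<open>
  Two of the $p+2$ factors $E$ are applied to the point mass and produce at most $d$, since a column
  of $E$ is no longer than a column of $A$; the remaining factors cost $\<lambda>$ each.
\<close>

lemma closed_walks_at:
  assumes v: "v \<in> V"
  shows "(act V A ^^ (p + 2)) (point_mass v) v \<le> d ^ (p + 2) / n + lam ^ p * d"
proof -
  let ?g = "act V E (point_mass v)"
  have "(act V E ^^ (p + 2)) (point_mass v) v = inner_on V (point_mass v) (act V E ((act V E ^^ p) ?g))"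
    using v fin by (simp add: inner_on_point_mass funpow_swap1)
  also have "\<dots> = inner_on V ?g ((act V E ^^ p) ?g)"
    by (simp add: act_symmetric[of E, OF E_sym])
  also have "\<dots> \<le> lam ^ p * inner_on V ?g ?g"
    using inner_on_le_of_norms[of ?g 1 ?g "(act V E ^^ p) ?g" "lam ^ p"] E_power_norm[of p ?g] lam_pos
    by simp
  also have "\<dots> \<le> lam ^ p * d"
    using norm_E_le_norm_A[of "point_mass v"] norm_act_point_mass[OF v] lam_pos by simp
  finally show ?thesis using act_power_point_mass[OF v v, of "Suc p"] by simp
qed

lemma closed_walks_total:
  "(\<Sum>x\<in>V. inner_on V ((act V A ^^ Suc j) (point_mass x)) ((act V A ^^ Suc j) (point_mass x)))
     \<le> d ^ (2 * j + 2) + n * d * lam ^ (2 * j)"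
proof -
  have "inner_on V ((act V A ^^ Suc j) (point_mass x)) ((act V A ^^ Suc j) (point_mass x))
        = (act V A ^^ (2 * j + 2)) (point_mass x) x" if "x \<in> V" for x
  proof -
    have "inner_on V ((act V A ^^ Suc j) (point_mass x)) ((act V A ^^ Suc j) (point_mass x))
          = inner_on V (point_mass x) ((act V A ^^ Suc j) ((act V A ^^ Suc j) (point_mass x)))"
      by (rule act_power_symmetric) (rule sym)
    also have "(act V A ^^ Suc j) ((act V A ^^ Suc j) (point_mass x)) = (act V A ^^ (2 * j + 2)) (point_mass x)"
      using funpow_add[of "Suc j" "Suc j" "act V A"] by (simp add: mult_2 fun_eq_iff)
    finally show ?thesis using that fin by (simp add: inner_on_point_mass)
  qed
  then have "(\<Sum>x\<in>V. inner_on V ((act V A ^^ Suc j) (point_mass x)) ((act V A ^^ Suc j) (point_mass x)))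
     \<le> (\<Sum>x\<in>V. d ^ (2 * j + 2) / n + lam ^ (2 * j) * d)"
    by (intro sum_mono) (simp only: closed_walks_at)
  also have "\<dots> = d ^ (2 * j + 2) + n * d * lam ^ (2 * j)"
    using n_pos by (simp add: field_simps)
  finally show ?thesis .
qed

end

section \<open>Walks in a subkernel\<close>

locale pseudorandom_sub = pseudorandom V A d lam
  for V :: "'v set" and A :: "'v \<Rightarrow> 'v \<Rightarrow> real" and d lam :: real +
  fixes B :: "'v \<Rightarrow> 'v \<Rightarrow> real"
  assumes B_sym: "B x y = B y x"
    and B_nonneg: "B x y \<ge> 0" and B_le: "B x y \<le> A x y"
begin

abbreviation "Bpow j \<equiv> (act V B ^^ j)"
abbreviation "ones \<equiv> (\<lambda>_. 1) :: 'v \<Rightarrow> real"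

definition moment :: "nat \<Rightarrow> real" where
  "moment j = inner_on V ones (Bpow j ones)"

lemma moment_add: "inner_on V (Bpow i ones) (Bpow j ones) = moment (i + j)"
  by (simp add: moment_def act_power_symmetric[of B, OF B_sym] funpow_add)

lemma sum_BB_point_mass: "x \<in> V \<Longrightarrow> sum (Bpow j (point_mass x)) V = Bpow j ones x"
proof -
  assume x: "x \<in> V"
  have "sum (Bpow j (point_mass x)) V = inner_on V (Bpow j (point_mass x)) ones" by (simp add: inner_on_def)
  also have "\<dots> = inner_on V (point_mass x) (Bpow j ones)" by (rule act_power_symmetric) (rule B_sym)
  finally show ?thesis using x fin by (simp add: inner_on_point_mass)
qed

text \<open>
  Mantel's argument. With $k = j+1$ the inequality comes from
  $\langle B^{k-1} D, B^k D \rangle \<ge> 0$ for $D = A - B$, which holds entry by entry. Of the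
  four terms of the expansion the two mixed ones are equal, and the last one counts closed walks of
  length $2k+1$ in the subkernel.
\<close>

lemma walk_inequality:
  fixes j :: nat
  defines "S \<equiv> (\<Sum>x\<in>V. inner_on V ((act V A ^^ Suc j) (point_mass x)) ((act V A ^^ Suc j) (point_mass x)))"
    and "t \<equiv> (\<Sum>x\<in>V. Bpow (2 * j + 3) (point_mass x) x)"
  shows "2 * (d / n) * moment (2 * j + 2) \<le> d\<^sup>2 / n * moment (2 * j + 1) + 3 * lam * S + t"
proof -
  define p where "p x = Bpow j (point_mass x)" for x
  define q where "q x = Bpow (Suc j) (point_mass x)" for x
  have Bp: "act V B (p x) = q x" for x by (simp add: p_def q_def)
  have bounds: "0 \<le> B x y \<and> B x y \<le> A x y" for x y using B_nonneg B_le by simp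
  have p_nn: "p x y \<ge> 0" and q_nn: "q x y \<ge> 0" for x y
    unfolding p_def q_def by (intro act_power_nonneg B_nonneg point_mass_nonneg)+
  have qA: "q x y \<le> (act V A ^^ Suc j) (point_mass x) y" for x y
    unfolding q_def by (intro act_power_mono bounds point_mass_nonneg)
  have pA: "act V A (p x) y \<le> (act V A ^^ Suc j) (point_mass x) y" for x y
    unfolding p_def using p_nn[of x, unfolded p_def] A_nonneg bounds
    by (auto intro!: act_mono act_power_mono point_mass_nonneg)
  have mono_norm: "inner_on V f f \<le> inner_on V g g" if "\<And>y. 0 \<le> f y \<and> f y \<le> g y" for f g :: "'v \<Rightarrow> real"
    unfolding inner_on_def using that by (intro sum_mono mult_mono) (auto intro: order_trans)
  have Sq: "(\<Sum>x\<in>V. inner_on V (q x) (q x)) \<le> S"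
    unfolding S_def using q_nn qA by (intro sum_mono mono_norm) auto
  have Sp: "(\<Sum>x\<in>V. inner_on V (act V A (p x)) (act V A (p x))) \<le> S"
    unfolding S_def using pA by (intro sum_mono mono_norm) (auto intro!: act_nonneg A_nonneg p_nn)
  \<comment> \<open>The rows of the two factors are the images of $p$ and $q = B p$ under $A - B$.\<close>
  have key: "0 \<le> inner_on V (act V A (p x)) (act V A (q x)) - inner_on V (act V A (p x)) (act V B (q x))
                 - inner_on V (q x) (act V A (q x)) + inner_on V (q x) (act V B (q x))" for x
  proof -
    let ?D = "\<lambda>x y. A x y - B x y"
    have "0 \<le> inner_on V (act V ?D (p x)) (act V ?D (q x))"
      unfolding inner_on_def using B_le p_nn q_nn
      by (intro sum_nonneg mult_nonneg_nonneg act_nonneg) auto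
    also have "\<dots> = inner_on V (\<lambda>y. act V A (p x) y - q x y) (\<lambda>y. act V A (q x) y - act V B (q x) y)"
      by (simp only: act_kernel_diff[abs_def] Bp)
    finally show ?thesis by (simp add: inner_on_diff inner_on_diff_right)
  qed
  \<comment> \<open>Both mixed terms are the trace of $B^{2k} A$.\<close>
  have swap: "(\<Sum>x\<in>V. inner_on V (act V A (p x)) (act V B (q x))) = (\<Sum>x\<in>V. inner_on V (q x) (act V A (q x)))"
  proof -
    have "(\<Sum>x\<in>V. inner_on V (act V A (p x)) (act V B (q x)))
        = (\<Sum>x\<in>V. inner_on V ((\<lambda>f. act V A (Bpow j f)) (point_mass x)) (Bpow (Suc (Suc j)) (point_mass x)))"
      by (simp add: p_def q_def)
    also have "\<dots> = (\<Sum>x\<in>V. inner_on V ((\<lambda>f. Bpow j (act V A f)) (point_mass x)) (Bpow (Suc (Suc j)) (point_mass x)))"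
      by (rule sum_inner_on_point_mass_adjoint[OF fin])
        (simp_all only: act_power_symmetric[of B, OF B_sym] act_symmetric[of A, OF sym])
    also have "\<dots> = (\<Sum>x\<in>V. inner_on V ((\<lambda>f. Bpow (Suc j) (act V A f)) (point_mass x)) (Bpow (Suc j) (point_mass x)))"
      by (simp add: act_symmetric[of B, OF B_sym])
    also have "\<dots> = (\<Sum>x\<in>V. inner_on V ((\<lambda>f. act V A (Bpow (Suc j) f)) (point_mass x)) (Bpow (Suc j) (point_mass x)))"
      by (rule sum_inner_on_point_mass_adjoint[OF fin])
        (simp_all only: act_power_symmetric[of B, OF B_sym] act_symmetric[of A, OF sym])
    finally show ?thesis by (simp add: q_def inner_on_commute)
  qed
  have t: "(\<Sum>x\<in>V. inner_on V (q x) (act V B (q x))) = t"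
    unfolding t_def
  proof (intro sum.cong refl)
    fix x assume x: "x \<in> V"
    have "inner_on V (q x) (act V B (q x)) = inner_on V (point_mass x) (Bpow (Suc j) (Bpow (Suc (Suc j)) (point_mass x)))"
      unfolding q_def by (subst act_power_symmetric[of B, OF B_sym]) simp
    also have "Bpow (Suc j) (Bpow (Suc (Suc j)) (point_mass x)) = Bpow (2 * j + 3) (point_mass x)"
      using funpow_add[of "Suc j" "Suc (Suc j)" "act V B"]
      by (simp add: fun_eq_iff mult_2 eval_nat_numeral del: funpow.simps)
    finally show "inner_on V (q x) (act V B (q x)) = Bpow (2 * j + 3) (point_mass x) x"
      using x fin by (simp add: inner_on_point_mass)
  qed
  have lower: "d / n * moment (2 * j + 2) - lam * S \<le> (\<Sum>x\<in>V. inner_on V (q x) (act V A (q x)))"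
  proof -
    have "inner_on V (q x) (act V A (q x)) \<ge> d / n * (Bpow (Suc j) ones x)\<^sup>2 - lam * inner_on V (q x) (q x)"
      if x: "x \<in> V" for x
    proof -
      have "inner_on V (q x) (act V A (q x))
            = d / n * sum (q x) V * sum (q x) V + inner_on V (q x) (act V E (q x))"
        by (rule inner_on_act_split)
      then show ?thesis using E_form_bound[of "q x"] sum_BB_point_mass[OF x, of "Suc j"]
        by (simp add: q_def power2_eq_square algebra_simps abs_le_iff del: funpow.simps)
    qed
    then have "(\<Sum>x\<in>V. inner_on V (q x) (act V A (q x)))
        \<ge> (\<Sum>x\<in>V. d / n * (Bpow (Suc j) ones x)\<^sup>2 - lam * inner_on V (q x) (q x))"
      by (intro sum_mono) simp
    also have "(\<Sum>x\<in>V. d / n * (Bpow (Suc j) ones x)\<^sup>2 - lam * inner_on V (q x) (q x))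
        = d / n * inner_on V (Bpow (Suc j) ones) (Bpow (Suc j) ones) - lam * (\<Sum>x\<in>V. inner_on V (q x) (q x))"
      by (simp add: sum_subtractf sum_distrib_left inner_on_def power2_eq_square algebra_simps del: funpow.simps)
    also have "inner_on V (Bpow (Suc j) ones) (Bpow (Suc j) ones) = moment (2 * j + 2)"
      using moment_add[of "Suc j" "Suc j"] by (simp add: mult_2 del: funpow.simps)
    finally show ?thesis using mult_left_mono[OF Sq, of lam] lam_pos by linarith
  qed
  have upper: "(\<Sum>x\<in>V. inner_on V (act V A (p x)) (act V A (q x))) \<le> d\<^sup>2 / n * moment (2 * j + 1) + lam * S"
  proof -
    have "inner_on V (act V A (p x)) (act V A (q x)) \<le> d\<^sup>2 / n * (Bpow j ones x * Bpow (Suc j) ones x)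
        + lam / 2 * (inner_on V (act V A (p x)) (act V A (p x)) + inner_on V (q x) (q x))"
      if x: "x \<in> V" for x
      using E_form_bound2[of "p x" "q x"] inner_on_act_act[of "p x" "q x"]
        sum_BB_point_mass[OF x, of j] sum_BB_point_mass[OF x, of "Suc j"]
      by (simp add: p_def q_def algebra_simps abs_le_iff del: funpow.simps)
    then have "(\<Sum>x\<in>V. inner_on V (act V A (p x)) (act V A (q x)))
        \<le> (\<Sum>x\<in>V. d\<^sup>2 / n * (Bpow j ones x * Bpow (Suc j) ones x)
        + lam / 2 * (inner_on V (act V A (p x)) (act V A (p x)) + inner_on V (q x) (q x)))"
      by (intro sum_mono) simp
    also have "\<dots> = d\<^sup>2 / n * inner_on V (Bpow j ones) (Bpow (Suc j) ones)
        + lam / 2 * ((\<Sum>x\<in>V. inner_on V (act V A (p x)) (act V A (p x))) + (\<Sum>x\<in>V. inner_on V (q x) (q x)))"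
      by (simp only: sum.distrib sum_distrib_left[symmetric] inner_on_def)
    also have "inner_on V (Bpow j ones) (Bpow (Suc j) ones) = moment (2 * j + 1)"
      using moment_add[of j "Suc j"] by (simp add: mult_2 del: funpow.simps)
    finally show ?thesis
      using mult_left_mono[OF add_mono[OF Sp Sq], of "lam / 2"] lam_pos by (simp add: field_simps)
  qed
  have "0 \<le> (\<Sum>x\<in>V. inner_on V (act V A (p x)) (act V A (q x)) - inner_on V (act V A (p x)) (act V B (q x))
                 - inner_on V (q x) (act V A (q x)) + inner_on V (q x) (act V B (q x)))"
    by (intro sum_nonneg key)
  also have "\<dots> = (\<Sum>x\<in>V. inner_on V (act V A (p x)) (act V A (q x)))
      - 2 * (\<Sum>x\<in>V. inner_on V (q x) (act V A (q x))) + t"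
    by (simp add: sum.distrib sum_subtractf swap t)
  finally have "2 * (d / n * moment (2 * j + 2)) \<le> d\<^sup>2 / n * moment (2 * j + 1) + 3 * (lam * S) + t"
    using lower upper by linarith
  then show ?thesis by (simp only: mult.assoc)
qed

end


context pseudorandom_sub begin

text \<open>
  Write $y = m_1/n$ for the average degree and $a_i = m_{2i}$. Log-convexity gives
  $a_{j+1} \<ge> y^2 a_j$, hence $y\, m_{2j+1} \<le> a_{j+1}$ by Cauchy--Schwarz, and also
  $a_{j+1} \<ge> y^{2j+2} n$. Multiplying the hypothesis by $y$ then leaves
  $d\, y^{2j+1} (2y - d) \<le> T$, which is useful when $y > d/2$.
\<close>

lemma density_bound:
  fixes j :: nat and T :: real
  assumes walk: "2 * (d / n) * moment (2 * j + 2) \<le> d\<^sup>2 / n * moment (2 * j + 1) + T"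
    and T: "T \<ge> 0"
  shows "moment 1 \<le> n * d * (1 / 2 + 4 ^ j * T / d ^ (2 * j + 3))"
proof -
  define y where "y = moment 1 / n"
  have h: "moment 1 = n * y" using n_pos by (simp add: y_def)
  have "y \<le> d * (1 / 2 + 4 ^ j * T / d ^ (2 * j + 3))"
  proof (cases "y \<le> d / 2")
    case True
    have "d / 2 \<le> d / 2 + d * (4 ^ j * T / d ^ (2 * j + 3))" using d_pos T by simp
    then show ?thesis using True by (simp add: algebra_simps)
  next
    case False
    then have y: "y > d / 2" "y > 0" using d_pos by auto
    define a where "a i = inner_on V (Bpow i ones) (Bpow i ones)" for i
    have a_moment: "a i = moment (2 * i)" for i
      using moment_add[of i i] by (simp add: a_def mult_2)
    have a_nn: "a i \<ge> 0" for i by (simp add: a_def inner_on_nonneg)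
    have a_lc: "(a (Suc i))\<^sup>2 \<le> a i * a (Suc (Suc i))" for i
      unfolding a_def by (rule moment_log_convex) (rule B_sym)
    have a0: "a 0 = n" by (simp add: a_def inner_on_def)
    have "(moment 1)\<^sup>2 \<le> inner_on V ones ones * a 1"
      unfolding moment_def a_def using cauchy_schwarz_inner_on[of V ones "Bpow 1 ones"] by simp
    then have "n * (n * y\<^sup>2) \<le> n * a 1"
      unfolding h by (simp add: inner_on_def power2_eq_square algebra_simps)
    then have a1: "y\<^sup>2 * a 0 \<le> a 1"
      using n_pos by (simp add: a0 mult.commute)
    have grow: "(y\<^sup>2) ^ Suc j * n \<le> a (Suc j)"
      using log_convex_growth[of a "y\<^sup>2" "Suc j", OF a_nn a_lc a1] a0 by simp
    have ratio: "y\<^sup>2 * a j \<le> a (Suc j)"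
      by (rule log_convex_ratio[of a "y\<^sup>2" j, OF a_nn a_lc a1])
    have "(y * moment (2 * j + 1))\<^sup>2 = y\<^sup>2 * (moment (2 * j + 1))\<^sup>2" by (simp add: power_mult_distrib)
    also have "(moment (2 * j + 1))\<^sup>2 \<le> a j * a (Suc j)"
      using cauchy_schwarz_inner_on[of V "Bpow j ones" "Bpow (Suc j) ones"] moment_add[of j "Suc j"]
      by (simp add: a_def mult_2 del: funpow.simps)
    then have "y\<^sup>2 * (moment (2 * j + 1))\<^sup>2 \<le> (y\<^sup>2 * a j) * a (Suc j)"
      by (simp add: mult_left_mono mult.assoc)
    also have "\<dots> \<le> a (Suc j) * a (Suc j)" by (rule mult_right_mono[OF ratio a_nn])
    also have "\<dots> = (a (Suc j))\<^sup>2" by (simp add: power2_eq_square)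
    finally have m: "y * moment (2 * j + 1) \<le> a (Suc j)"
      using a_nn by (rule power2_le_imp_le)
    have aj: "a (Suc j) = moment (2 * j + 2)" by (simp add: a_moment)
    have "y * (2 * (d / n) * a (Suc j)) \<le> y * (d\<^sup>2 / n * moment (2 * j + 1) + T)"
      unfolding aj by (intro mult_left_mono[OF walk]) (use y in simp)
    also have "\<dots> = d\<^sup>2 / n * (y * moment (2 * j + 1)) + y * T" by (simp add: algebra_simps)
    also have "\<dots> \<le> d\<^sup>2 / n * a (Suc j) + y * T"
      using mult_left_mono[OF m, of "d\<^sup>2 / n"] n_pos by simp
    finally have "d / n * (2 * y - d) * a (Suc j) \<le> y * T"
      by (simp add: algebra_simps power2_eq_square)
    moreover have "d / n * (2 * y - d) * ((y\<^sup>2) ^ Suc j * n) \<le> d / n * (2 * y - d) * a (Suc j)"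
      using grow d_pos n_pos y by (intro mult_left_mono) auto
    moreover have "d / n * (2 * y - d) * ((y\<^sup>2) ^ Suc j * n) = y * (d * (2 * y - d) * y ^ (2 * j + 1))"
    proof -
      have "(y\<^sup>2) ^ Suc j = y * y ^ (2 * j + 1)" 
        unfolding power_mult[symmetric] power_Suc[symmetric] by (rule arg_cong) simp
      then show ?thesis using n_pos by simp
    qed
    ultimately have "y * (d * (2 * y - d) * y ^ (2 * j + 1)) \<le> y * T" by linarith
    then have "d * (2 * y - d) * y ^ (2 * j + 1) \<le> T" using y by simp
    moreover have "d * (2 * y - d) * (d / 2) ^ (2 * j + 1) \<le> d * (2 * y - d) * y ^ (2 * j + 1)"
      using y d_pos by (intro mult_left_mono power_mono) auto
    ultimately have "d * (2 * y - d) * (d / 2) ^ (2 * j + 1) \<le> T" by linarith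
    moreover have "(d / 2) ^ (2 * j + 1) = d ^ (2 * j + 1) / (2 * 4 ^ j)"
    proof -
      have "(2::real) ^ (2 * j + 1) = 2 * 4 ^ j" by (simp add: power_mult)
      then show ?thesis by (simp only: power_divide)
    qed
    ultimately have "d * (2 * y - d) * d ^ (2 * j + 1) / (2 * 4 ^ j) \<le> T"
      by (metis times_divide_eq_right)
    then have "d * (2 * y - d) * d ^ (2 * j + 1) \<le> T * (2 * 4 ^ j)"
      by (subst (asm) pos_divide_le_eq) simp_all
    moreover have "d * (2 * y - d) * d ^ (2 * j + 1) = (2 * y - d) * d ^ (2 * j + 2)"
      by simp
    ultimately have "(2 * y - d) * d ^ (2 * j + 2) \<le> T * (2 * 4 ^ j)" by linarith
    then have "2 * y - d \<le> T * (2 * 4 ^ j) / (d ^ (2 * j + 2))"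
      using d_pos by (subst pos_le_divide_eq) simp_all
    moreover have "T * (2 * 4 ^ j) / (d ^ (2 * j + 2)) = 2 * (d * (4 ^ j * T / d ^ (2 * j + 3)))"
    proof -
      have "d ^ (2 * j + 3) = d * d ^ (2 * j + 2)" by (simp add: eval_nat_numeral)
      then show ?thesis using d_pos by simp
    qed
    ultimately show ?thesis by (simp only: distrib_left)
  qed
  then have "n * y \<le> n * (d * (1 / 2 + 4 ^ j * T / d ^ (2 * j + 3)))"
    using n_pos by (intro mult_left_mono) auto
  then show ?thesis by (simp only: h mult.assoc)
qed

end

section \<open>Closed walks with a repeated vertex\<close>

text \<open>
  The endpoints are kept apart from the list of interior vertices, so that cutting a walk at an
  interior vertex is a plain product, also when one of the two pieces is a single step.
\<close>

fun walk_weight :: "('v \<Rightarrow> 'v \<Rightarrow> real) \<Rightarrow> 'v \<Rightarrow> 'v list \<Rightarrow> 'v \<Rightarrow> real" where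
  "walk_weight M x [] y = M x y"
| "walk_weight M x (z # zs) y = M x z * walk_weight M z zs y"

fun cycle_weight :: "('v \<Rightarrow> 'v \<Rightarrow> real) \<Rightarrow> 'v list \<Rightarrow> real" where
  "cycle_weight M [] = 0"
| "cycle_weight M (x # xs) = walk_weight M x xs x"

definition seqs :: "'v set \<Rightarrow> nat \<Rightarrow> 'v list set" where
  "seqs V a = {xs. set xs \<subseteq> V \<and> length xs = a}"

lemma finite_seqs: "finite V \<Longrightarrow> finite (seqs V a)"
  by (simp add: seqs_def finite_lists_length_eq)

lemma seqs_0: "seqs V 0 = {[]}"
  by (auto simp: seqs_def)

lemma sum_seqs_Suc: "(\<Sum>xs\<in>seqs V (Suc a). F xs) = (\<Sum>x\<in>V. \<Sum>xs\<in>seqs V a. F (x # xs))"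
proof -
  have "(\<Sum>xs\<in>seqs V (Suc a). F xs) = (\<Sum>(xs, x)\<in>seqs V a \<times> V. F (x # xs))"
    unfolding seqs_def lists_length_Suc_eq
    by (subst sum.reindex) (auto simp: inj_on_def case_prod_beta)
  also have "\<dots> = (\<Sum>xs\<in>seqs V a. \<Sum>x\<in>V. F (x # xs))"
    by (simp add: sum.cartesian_product)
  also have "\<dots> = (\<Sum>x\<in>V. \<Sum>xs\<in>seqs V a. F (x # xs))" by (rule sum.swap)
  finally show ?thesis .
qed

lemma sum_seqs_append:
  "(\<Sum>xs\<in>seqs V a. \<Sum>ys\<in>seqs V b. F (xs @ ys)) = (\<Sum>zs\<in>seqs V (a + b). F zs)"
proof (induction a arbitrary: F)
  case (Suc a)
  then show ?case using Suc[of "\<lambda>zs. F (_ # zs)"] by (simp add: sum_seqs_Suc)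
qed (simp add: seqs_0)

lemma walk_weight_append:
  "walk_weight M x (xs @ z # ys) y = walk_weight M x xs z * walk_weight M z ys y"
  by (induction xs arbitrary: x) auto

text \<open>
  A closed walk may be started at any of its vertices.
\<close>

lemma cycle_weight_swap: "cycle_weight M (xs @ ys) = cycle_weight M (ys @ xs)"
proof (cases "xs = [] \<or> ys = []")
  case False
  then obtain x xs' y ys' where "xs = x # xs'" "ys = y # ys'" by (meson neq_Nil_conv)
  then show ?thesis by (simp add: walk_weight_append mult.commute)
qed auto

lemma walk_weight_nonneg: "(\<And>x y. M x y \<ge> 0) \<Longrightarrow> walk_weight M x xs y \<ge> 0"
  by (induction xs arbitrary: x) auto

lemma cycle_weight_nonneg: "(\<And>x y. M x y \<ge> 0) \<Longrightarrow> cycle_weight M xs \<ge> 0"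
  by (cases xs) (auto intro: walk_weight_nonneg)

lemma cycle_weight_mono:
  assumes "\<And>x y. 0 \<le> M x y \<and> M x y \<le> N x y"
  shows "cycle_weight M xs \<le> cycle_weight N xs"
proof -
  have N: "N x y \<ge> 0" for x y using assms[of x y] by linarith
  have "walk_weight M x xs y \<le> walk_weight N x xs y" for x xs y
    using assms N by (induction xs arbitrary: x) (auto intro!: mult_mono walk_weight_nonneg)
  then show ?thesis by (cases xs) auto
qed

lemma sum_walk_weight:
  assumes "finite V" "y \<in> V"
  shows "(\<Sum>zs\<in>seqs V a. walk_weight M x zs y) = (act V M ^^ Suc a) (point_mass y) x"
proof (induction a arbitrary: x)
  case 0
  then show ?case using assms by (simp add: seqs_0 act_point_mass)
next
  case (Suc a)
  then show ?case by (simp add: sum_seqs_Suc sum_distrib_left[symmetric] act_def)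
qed

lemma sum_cycle_weight:
  assumes "finite V"
  shows "(\<Sum>xs\<in>seqs V (Suc a). cycle_weight M xs) = (\<Sum>x\<in>V. (act V M ^^ Suc a) (point_mass x) x)"
  using assms by (simp add: sum_seqs_Suc sum_walk_weight del: funpow.simps)

text \<open>
  Rotated to start at a repeated vertex, a closed walk of length $m$ is the concatenation of two
  closed walks of lengths $p + q = m$. There are at most $m^2$ choices for the positions of the two
  occurrences.
\<close>

lemma sum_nondistinct_cycle_weight:
  fixes M :: "'v \<Rightarrow> 'v \<Rightarrow> real"
  assumes fin: "finite V" and nn: "\<And>x y. M x y \<ge> 0"
    and bound: "\<And>y p q. y \<in> V \<Longrightarrow> p \<ge> 1 \<Longrightarrow> q \<ge> 1 \<Longrightarrow> p + q = m \<Longrightarrow>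
                  (act V M ^^ p) (point_mass y) y * (act V M ^^ q) (point_mass y) y \<le> \<beta>"
    and \<beta>: "\<beta> \<ge> 0"
  shows "(\<Sum>ws\<in>{ws\<in>seqs V m. \<not> distinct ws}. cycle_weight M ws) \<le> (real m)\<^sup>2 * real (card V) * \<beta>"
proof -
  define I where "I = {(a, b). a < m \<and> b < m \<and> a + b + 2 \<le> m}"
  define Z where "Z i = (case i of (a, b) \<Rightarrow> V \<times> seqs V b \<times> seqs V (m - 2 - a - b) \<times> seqs V a)" for i
  define g :: "(nat \<times> nat) \<times> 'v \<times> 'v list \<times> 'v list \<times> 'v list \<Rightarrow> 'v list"
    where "g = (\<lambda>(i, y, bs, cs, as). as @ [y] @ bs @ [y] @ cs)"
  have I_sub: "I \<subseteq> {..<m} \<times> {..<m}" by (auto simp: I_def)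
  have finI: "finite I" by (rule finite_subset[OF I_sub]) simp
  have cardI: "real (card I) \<le> (real m)\<^sup>2"
    using card_mono[OF _ I_sub] by (simp add: card_cartesian_product power2_eq_square flip: of_nat_mult)
  have finZ: "finite (Z i)" for i
    by (cases i) (auto simp: Z_def fin finite_seqs)
  \<comment> \<open>\<open>g\<close> need not be injective: a walk with several repetitions is counted several times.\<close>
  have sub: "{ws\<in>seqs V m. \<not> distinct ws} \<subseteq> g ` Sigma I Z"
  proof
    fix ws assume ws: "ws \<in> {ws\<in>seqs V m. \<not> distinct ws}"
    then obtain as bs cs y where dec: "ws = as @ [y] @ bs @ [y] @ cs"
      using not_distinct_decomp[of ws] by blast
    have "((length as, length bs), y, bs, cs, as) \<in> Sigma I Z"
      using ws by (auto simp: dec seqs_def I_def Z_def)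
    moreover have "ws = g ((length as, length bs), y, bs, cs, as)" by (simp add: g_def dec)
    ultimately show "ws \<in> g ` Sigma I Z" by blast
  qed
  have "(\<Sum>ws\<in>{ws\<in>seqs V m. \<not> distinct ws}. cycle_weight M ws)
        \<le> (\<Sum>ws\<in>g ` Sigma I Z. cycle_weight M ws)"
    using sub finI finZ nn by (intro sum_mono2) (auto intro: cycle_weight_nonneg)
  also have "\<dots> \<le> (\<Sum>z\<in>Sigma I Z. (cycle_weight M \<circ> g) z)"
    using finI finZ nn by (intro sum_image_le) (auto intro: cycle_weight_nonneg)
  also have "\<dots> = (\<Sum>i\<in>I. \<Sum>z\<in>Z i. cycle_weight M (g (i, z)))"
    using finI finZ by (subst sum.Sigma) auto
  also have "\<dots> \<le> (\<Sum>i\<in>I. real (card V) * \<beta>)"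
  proof (rule sum_mono)
    fix i assume "i \<in> I"
    then obtain a b where i: "i = (a, b)" and ab: "a + b + 2 \<le> m" by (auto simp: I_def)
    define c where "c = m - 2 - a - b"
    have abc: "Suc b + Suc (c + a) = m" using ab by (simp add: c_def)
    have cyc: "cycle_weight M (g (i, y, bs, cs, as)) = walk_weight M y bs y * walk_weight M y (cs @ as) y"
      for y bs cs as
      using cycle_weight_swap[of M as "[y] @ bs @ [y] @ cs"] by (simp add: g_def walk_weight_append)
    have "(\<Sum>z\<in>Z i. cycle_weight M (g (i, z)))
        = (\<Sum>y\<in>V. \<Sum>bs\<in>seqs V b. \<Sum>cs\<in>seqs V c. \<Sum>as\<in>seqs V a.
             walk_weight M y bs y * walk_weight M y (cs @ as) y)"
      by (simp add: Z_def i c_def sum.cartesian_product' flip: cyc)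
    also have "\<dots> = (\<Sum>y\<in>V. (\<Sum>bs\<in>seqs V b. walk_weight M y bs y) *
             (\<Sum>cs\<in>seqs V c. \<Sum>as\<in>seqs V a. walk_weight M y (cs @ as) y))"
      by (simp only: sum_distrib_left[symmetric] sum_distrib_right[symmetric])
    also have "\<dots> = (\<Sum>y\<in>V. (act V M ^^ Suc b) (point_mass y) y * (act V M ^^ Suc (c + a)) (point_mass y) y)"
    proof (intro sum.cong refl)
      fix y assume y: "y \<in> V"
      have "(\<Sum>cs\<in>seqs V c. \<Sum>as\<in>seqs V a. walk_weight M y (cs @ as) y)
            = (\<Sum>zs\<in>seqs V (c + a). walk_weight M y zs y)"
        by (rule sum_seqs_append)
      also have "\<dots> = (act V M ^^ Suc (c + a)) (point_mass y) y" by (rule sum_walk_weight[OF fin y])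
      finally have *: "(\<Sum>cs\<in>seqs V c. \<Sum>as\<in>seqs V a. walk_weight M y (cs @ as) y)
            = (act V M ^^ Suc (c + a)) (point_mass y) y" .
      show "(\<Sum>bs\<in>seqs V b. walk_weight M y bs y) *
             (\<Sum>cs\<in>seqs V c. \<Sum>as\<in>seqs V a. walk_weight M y (cs @ as) y)
          = (act V M ^^ Suc b) (point_mass y) y * (act V M ^^ Suc (c + a)) (point_mass y) y"
        unfolding * sum_walk_weight[OF fin y] ..
    qed
    also have "\<dots> \<le> (\<Sum>y\<in>V. \<beta>)"
      by (intro sum_mono bound) (use abc in auto)
    finally show "(\<Sum>z\<in>Z i. cycle_weight M (g (i, z))) \<le> real (card V) * \<beta>" by simp
  qed
  also have "\<dots> = real (card I) * (real (card V) * \<beta>)" by simp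
  also have "\<dots> \<le> (real m)\<^sup>2 * (real (card V) * \<beta>)"
    using cardI \<beta> by (intro mult_right_mono) auto
  finally show ?thesis by (simp add: mult.assoc)
qed

lemma walk_weight_nth:
  assumes "walk_weight M x xs y \<noteq> 0" "i \<le> length xs"
  shows "M ((x # xs @ [y]) ! i) ((xs @ [y]) ! i) \<noteq> 0"
  using assms
proof (induction xs arbitrary: x i)
  case (Cons z zs)
  then show ?case by (cases i) auto
qed simp

lemma cycle_weight_nth:
  assumes "cycle_weight M ws \<noteq> 0" "i < length ws"
  shows "M (ws ! i) (ws ! (Suc i mod length ws)) \<noteq> 0"
proof -
  obtain x xs where ws: "ws = x # xs" using assms by (cases ws) auto
  have "M ((x # xs @ [x]) ! i) ((xs @ [x]) ! i) \<noteq> 0"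
    using assms by (intro walk_weight_nth[of M x xs x]) (auto simp: ws)
  moreover have "(x # xs @ [x]) ! i = ws ! i"
    using assms(2) by (auto simp: ws nth_Cons nth_append split: nat.split)
  moreover have "(xs @ [x]) ! i = ws ! (Suc i mod length ws)"
  proof (cases "i = length xs")
    case False
    then have "Suc i < length ws" using assms(2) by (simp add: ws)
    then show ?thesis by (simp add: ws nth_append)
  qed (simp add: ws nth_append)
  ultimately show ?thesis by simp
qed


section \<open>The spectrum after subtracting the constant part\<close>

text \<open>
  The constant vector is an eigenvector of $P$ for $x$. Eliminating in the bordered matrix
  $Q = [1, c 1^T; 1, P]$ by rows gives $\det Q = \det (P - c J)$; eliminating by
  columns gives $x \det Q = (x - nc) \det P$. The identity holds over
  polynomials, so applied to characteristic matrices it keeps track of multiplicities.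
\<close>

lemma det_subtract_constant:
  fixes P N :: "'a::idom mat"
  assumes P: "P \<in> carrier_mat n n" and N: "N \<in> carrier_mat n n"
    and entries: "\<And>i j. i < n \<Longrightarrow> j < n \<Longrightarrow> N $$ (i, j) = P $$ (i, j) - c"
    and rows: "\<And>i. i < n \<Longrightarrow> (\<Sum>j<n. P $$ (i, j)) = x"
  shows "x * det N = (x - of_nat n * c) * det P"
proof -
  define U where "U = mat 1 n (\<lambda>_. c)"
  define L where "L = mat n 1 (\<lambda>_. 1 :: 'a)"
  define K where "K = mat n 1 (\<lambda>_. - 1 :: 'a)"
  define X where "X = mat 1 1 (\<lambda>_. x)"
  define Y where "Y = mat 1 1 (\<lambda>_. x - of_nat n * c)"
  define Q where "Q = four_block_mat (1\<^sub>m 1) U L P"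
  have c[simp]: "U \<in> carrier_mat 1 n" "L \<in> carrier_mat n 1" "K \<in> carrier_mat n 1"
    "X \<in> carrier_mat 1 1" "Y \<in> carrier_mat 1 1"
    by (auto simp: U_def L_def K_def X_def Y_def)
  note block_simps = left_mult_one_mat[OF c(1)] right_mult_one_mat[OF c(1)] right_add_zero_mat[OF c(1)]
    left_add_zero_mat[OF c(1)] right_mult_one_mat[OF c(2)] right_add_zero_mat[OF c(2)]
    right_mult_zero_mat[OF c(2)] left_add_zero_mat[OF P] right_mult_one_mat[OF P]
  note c' = c[unfolded One_nat_def] block_simps[unfolded One_nat_def]
  have Qc: "Q \<in> carrier_mat (1 + n) (1 + n)" unfolding Q_def using P by (intro four_block_carrier_mat) auto
  have "Q = four_block_mat (1\<^sub>m 1) (0\<^sub>m 1 n) L (1\<^sub>m n) * four_block_mat (1\<^sub>m 1) U (0\<^sub>m n 1) N"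
  proof -
    have "L * U + 1\<^sub>m n * N = P"
      using P N by (intro eq_matI) (auto simp: L_def U_def scalar_prod_def entries)
    then show ?thesis
      unfolding Q_def
      by (subst mult_four_block_mat[of _ 1 1 _ n _ n _ _ 1 _ n]) (use N in \<open>simp_all add: c'\<close>)
  qed
  moreover have "det (four_block_mat (1\<^sub>m 1) (0\<^sub>m 1 n) L (1\<^sub>m n)) = 1"
    by (subst det_four_block_mat_upper_right_zero[of _ 1 _ n]) (simp_all add: c')
  moreover have "det (four_block_mat (1\<^sub>m 1) U (0\<^sub>m n 1) N) = det N"
    using N by (subst det_four_block_mat_lower_left_zero[of _ 1 _ n]) (simp_all add: c')
  ultimately have detQ: "det Q = det N"
    using det_mult[OF four_block_carrier_mat[OF one_carrier_mat[of 1] one_carrier_mat[of n]]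
        four_block_carrier_mat[OF one_carrier_mat[of 1] N]] by simp
  have "Q * four_block_mat X (0\<^sub>m 1 n) K (1\<^sub>m n) = four_block_mat Y U (0\<^sub>m n 1) P"
  proof -
    have e1: "1\<^sub>m 1 * X + U * K = Y"
      by (intro eq_matI) (auto simp: X_def Y_def U_def K_def scalar_prod_def)
    have e2: "L * X + P * K = 0\<^sub>m n 1"
      using P rows by (intro eq_matI)
        (auto simp: L_def X_def K_def scalar_prod_def sum_negf atLeast0LessThan)
    show ?thesis
      unfolding Q_def
      by (subst mult_four_block_mat[of _ 1 1 _ n _ n _ _ 1 _ n]) (use P e1 e2 in \<open>simp_all add: c'\<close>)
  qed
  then have "det (Q * four_block_mat X (0\<^sub>m 1 n) K (1\<^sub>m n)) = det Y * det P"
    using det_four_block_mat_lower_left_zero[OF c(5) c(1) refl P] by (simp only:)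
  moreover have "det (Q * four_block_mat X (0\<^sub>m 1 n) K (1\<^sub>m n)) = det Q * det X"
    using det_mult[OF Qc four_block_carrier_mat[OF c(4) one_carrier_mat]]
      det_four_block_mat_upper_right_zero[OF c(4) refl c(3) one_carrier_mat] by simp
  moreover have "det X = x" "det Y = x - of_nat n * c"
    using det_single[of X] det_single[of Y] by (simp_all add: X_def Y_def)
  ultimately show ?thesis by (simp add: detQ mult.commute)
qed

lemma real_symmetric_eigenvalue_real:
  fixes M :: "real mat"
  assumes M: "M \<in> carrier_mat n n" and sym: "\<And>i j. i < n \<Longrightarrow> j < n \<Longrightarrow> M $$ (i, j) = M $$ (j, i)"
    and root: "poly (char_poly (map_mat complex_of_real M)) z = 0"
  shows "z \<in> \<real>"
proof -
  let ?C = "map_mat complex_of_real M"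
  have C: "?C \<in> carrier_mat n n" using M by simp
  obtain v where v: "v \<in> carrier_vec n" "v \<noteq> 0\<^sub>v n" "?C *\<^sub>v v = z \<cdot>\<^sub>v v"
    using root eigenvalue_root_char_poly[OF C] M by (auto simp: eigenvalue_def eigenvector_def)
  have row: "(\<Sum>j<n. of_real (M $$ (i, j)) * v $ j) = z * v $ i" if i: "i < n" for i
  proof -
    have "(?C *\<^sub>v v) $ i = (\<Sum>j<n. of_real (M $$ (i, j)) * v $ j)"
      using i M v(1) by (simp add: scalar_prod_def atLeast0LessThan)
    then show ?thesis using i v by simp
  qed
  define s where "s = (\<Sum>i<n. \<Sum>j<n. cnj (v $ i) * of_real (M $$ (i, j)) * v $ j)"
  have "cnj s = (\<Sum>i<n. \<Sum>j<n. v $ i * of_real (M $$ (i, j)) * cnj (v $ j))"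
    by (simp add: s_def)
  also have "\<dots> = (\<Sum>j<n. \<Sum>i<n. v $ i * of_real (M $$ (i, j)) * cnj (v $ j))"
    by (rule sum.swap)
  also have "\<dots> = s"
    unfolding s_def by (intro sum.cong refl) (simp add: sym mult.commute mult.left_commute)
  finally have s_real: "s \<in> \<real>" by (simp add: Reals_cnj_iff)
  define w where "w = (\<Sum>i<n. (cmod (v $ i))\<^sup>2)"
  have "s = (\<Sum>i<n. cnj (v $ i) * (z * v $ i))"
    by (simp add: s_def row[symmetric] sum_distrib_left mult.assoc)
  also have "\<dots> = z * of_real w"
    unfolding w_def of_real_sum sum_distrib_left
    by (intro sum.cong refl) (simp add: complex_norm_square[symmetric] mult.commute mult.left_commute 
        flip: complex_norm_square of_real_power)
  finally have sz: "s = z * of_real w" .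
  obtain i where i: "i < n" "v $ i \<noteq> 0"
    using v by (metis eq_vecI carrier_vecD index_zero_vec)
  then have "w > 0"
    unfolding w_def by (intro sum_pos2[of _ i]) auto
  then have "z = s / of_real w" by (simp add: sz)
  then show ?thesis using s_real by simp
qed

lemma map_poly_real_linear_factors:
  "poly (map_poly complex_of_real (\<Prod>a\<leftarrow>as. [:- a, 1:])) z = (\<Prod>a\<leftarrow>as. z - of_real a)"
proof -
  interpret h: map_poly_inj_comm_ring_hom complex_of_real ..
  show ?thesis by (induction as) (simp_all add: hom_distribs algebra_simps)
qed

lemma real_symmetric_char_poly_splits:
  fixes M :: "real mat"
  assumes M: "M \<in> carrier_mat n n" and sym: "\<And>i j. i < n \<Longrightarrow> j < n \<Longrightarrow> M $$ (i, j) = M $$ (j, i)"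
  obtains as where "char_poly M = (\<Prod>a\<leftarrow>as. [:- a, 1:])" "length as = n"
proof -
  interpret h: map_poly_inj_comm_ring_hom complex_of_real ..
  let ?C = "map_mat complex_of_real M"
  have "?C \<in> carrier_mat n n" using M by simp
  from char_poly_factorized[OF this] obtain cs
    where cs: "char_poly ?C = (\<Prod>a\<leftarrow>cs. [:- a, 1:])" "length cs = n" by blast
  have "of_real (Re c) = c" if "c \<in> set cs" for c
  proof -
    have root: "poly (char_poly ?C) c = 0" unfolding cs(1) using linear_poly_root[OF that] .
    have "c \<in> \<real>" by (rule real_symmetric_eigenvalue_real[OF M _ root]) (erule (1) sym)
    then show ?thesis by (simp add: of_real_Re)
  qed
  then have cs_eq: "cs = map of_real (map Re cs)" by (simp add: map_idI)
  have "map_poly complex_of_real (\<Prod>a\<leftarrow>map Re cs. [:- a, 1:]) = (\<Prod>a\<leftarrow>map of_real (map Re cs). [:- a, 1:])"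
    by (induction cs) (simp_all add: hom_distribs)
  also have "\<dots> = char_poly ?C" by (simp only: cs_eq[symmetric] cs(1))
  also have "\<dots> = map_poly complex_of_real (char_poly M)" by (rule of_real_hom.char_poly_hom[OF M])
  finally have "char_poly M = (\<Prod>a\<leftarrow>map Re cs. [:- a, 1:])" using h.injectivity by metis
  then show thesis using that[of "map Re cs"] cs(2) by simp
qed

text \<open>
  Compare the two sides of the eigenvalue equation at an entry of the eigenvector of largest absolute
  value.
\<close>

lemma eigenvalue_le_row_sum:
  fixes M :: "real mat"
  assumes M: "M \<in> carrier_mat n n" and nn: "\<And>i j. i < n \<Longrightarrow> j < n \<Longrightarrow> M $$ (i, j) \<ge> 0"
    and rows: "\<And>i. i < n \<Longrightarrow> (\<Sum>j<n. M $$ (i, j)) = d"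
    and root: "poly (char_poly M) b = 0"
  shows "\<bar>b\<bar> \<le> d"
proof -
  obtain v where v: "v \<in> carrier_vec n" "v \<noteq> 0\<^sub>v n" "M *\<^sub>v v = b \<cdot>\<^sub>v v"
    using root eigenvalue_root_char_poly[OF M] M by (auto simp: eigenvalue_def eigenvector_def)
  obtain k where k: "k < n" "v $ k \<noteq> 0"
    using v by (metis eq_vecI carrier_vecD index_zero_vec)
  define m where "m = Max ((\<lambda>i. \<bar>v $ i\<bar>) ` {..<n})"
  have "m \<in> (\<lambda>i. \<bar>v $ i\<bar>) ` {..<n}" unfolding m_def using k by (intro Max_in) auto
  then obtain i where i: "i < n" "m = \<bar>v $ i\<bar>" by auto
  have m: "\<bar>v $ j\<bar> \<le> m" if "j < n" for j unfolding m_def using that by (intro Max_ge) auto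
  have "m > 0" using m[OF k(1)] k(2) by linarith
  have "b * v $ i = (\<Sum>j<n. M $$ (i, j) * v $ j)"
  proof -
    have "(M *\<^sub>v v) $ i = (\<Sum>j<n. M $$ (i, j) * v $ j)"
      using i M v(1) by (simp add: scalar_prod_def atLeast0LessThan)
    then show ?thesis using i v by simp
  qed
  then have "\<bar>b\<bar> * m = \<bar>\<Sum>j<n. M $$ (i, j) * v $ j\<bar>" using i by (simp add: abs_mult[symmetric])
  also have "\<dots> \<le> (\<Sum>j<n. \<bar>M $$ (i, j) * v $ j\<bar>)" by (rule sum_abs)
  also have "\<dots> \<le> (\<Sum>j<n. M $$ (i, j) * m)"
    using i nn m by (intro sum_mono) (auto simp: abs_mult intro!: mult_left_mono)
  also have "\<dots> = d * m" using rows[OF i(1)] by (simp add: sum_distrib_right[symmetric])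
  finally show ?thesis using \<open>m > 0\<close> by simp
qed

text \<open>
  Subtracting $(d/n) J$ replaces one root $d$ of the characteristic polynomial by $0$ and keeps all
  the others with multiplicity. Since $d$ is the largest root, it is the first entry of the
  decreasing list of roots, and all other roots lie between the second and the last entry.
\<close>

lemma deflated_eigenvalue_bound:
  fixes M :: "real mat"
  assumes M: "M \<in> carrier_mat n n" and sym: "\<And>i j. i < n \<Longrightarrow> j < n \<Longrightarrow> M $$ (i, j) = M $$ (j, i)"
    and nn: "\<And>i j. i < n \<Longrightarrow> j < n \<Longrightarrow> M $$ (i, j) \<ge> 0"
    and rows: "\<And>i. i < n \<Longrightarrow> (\<Sum>j<n. M $$ (i, j)) = d"
    and d: "d > 0" and n: "n > 0" and l: "l \<ge> 0"
  defines "ds \<equiv> rev (sorted_list_of_multiset (proots (char_poly M)))"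
    and "D \<equiv> mat n n (\<lambda>(i, j). M $$ (i, j) - d / real n)"
  assumes second: "max (ds ! 1) \<bar>ds ! (n - 1)\<bar> \<le> l"
    and root: "poly (char_poly (map_mat complex_of_real D)) z = 0"
  shows "cmod z \<le> l"
proof -
  have D: "D \<in> carrier_mat n n" by (simp add: D_def)
  obtain as where as: "char_poly M = (\<Prod>a\<leftarrow>as. [:- a, 1:])" and len: "length as = n"
    using real_symmetric_char_poly_splits[OF M sym] by blast
  have proots: "proots (char_poly M) = mset as"
  proof -
    have "(\<Prod>a\<leftarrow>as. [:- a, 1:]) \<noteq> 0" for as :: "real list"
      by (induction as) (auto simp del: mult_pCons_left)
    then have "proots (\<Prod>a\<leftarrow>as. [:- a, 1:]) = mset as"
      by (induction as) (simp_all add: proots_mult del: mult_pCons_left)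
    then show ?thesis by (simp only: as)
  qed
  have sum_const: "(\<Sum>j<m. [:f j:]) = [:\<Sum>j<m. f j:]" for f :: "nat \<Rightarrow> real" and m
    by (induction m) simp_all
  have eq: "[:0, 1:] * char_poly M = [:- d, 1:] * char_poly D"
  proof -
    have "[:0, 1:] * det (char_poly_matrix M)
          = ([:0, 1:] - of_nat n * [:d / real n:]) * det (char_poly_matrix D)"
    proof (rule det_subtract_constant)
      fix i j assume ij: "i < n" "j < n"
      then show "char_poly_matrix M $$ (i, j) = char_poly_matrix D $$ (i, j) - [:d / real n:]"
        using M D by (auto simp: char_poly_matrix_def D_def)
    next
      fix i assume i: "i < n"
      have "(\<Sum>j<n. char_poly_matrix D $$ (i, j))
            = (\<Sum>j<n. (if i = j then [:0, 1:] else 0) - [:M $$ (i, j) - d / real n:])"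
        using i D by (intro sum.cong refl) (auto simp: char_poly_matrix_def D_def)
      also have "\<dots> = [:0, 1:] - (\<Sum>j<n. [:M $$ (i, j) - d / real n:])"
        using i by (simp add: sum_subtractf)
      also have "(\<Sum>j<n. [:M $$ (i, j) - d / real n:]) = [:\<Sum>j<n. M $$ (i, j) - d / real n:]"
        by (rule sum_const)
      also have "(\<Sum>j<n. M $$ (i, j) - d / real n) = 0"
        using n rows[OF i] by (simp add: sum_subtractf)
      finally show "(\<Sum>j<n. char_poly_matrix D $$ (i, j)) = [:0, 1:]" by simp
    qed (use M D in auto)
    moreover have "[:0, 1:] - of_nat n * [:d / real n:] = [:- d, 1:]"
      using n by (simp add: of_nat_poly)
    ultimately show ?thesis by (simp only: char_poly_def)
  qed
  have "poly ([:0, 1:] * char_poly M) d = 0" unfolding eq by simp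
  then have "poly (char_poly M) d = 0" using d by simp
  then have d_in: "d \<in> set as"
    unfolding as by (auto simp: poly_prod_list prod_list_zero_iff)
  define rs where "rs = remove1 d as"
  have perm: "mset as = add_mset d (mset rs)" using d_in by (simp add: rs_def)
  have "char_poly M = [:- d, 1:] * (\<Prod>a\<leftarrow>rs. [:- a, 1:])"
    unfolding as prod_mset_prod_list[symmetric] mset_map perm by simp
  then have "[:- d, 1:] * ([:0, 1:] * (\<Prod>a\<leftarrow>rs. [:- a, 1:])) = [:- d, 1:] * char_poly D"
    using eq by (simp only: mult.left_commute)
  then have charD: "char_poly D = (\<Prod>a\<leftarrow>0 # rs. [:- a, 1:])" 
    by (subst (asm) mult_left_cancel) simp_all
  have "poly (char_poly (map_mat complex_of_real D)) z = (\<Prod>a\<leftarrow>0 # rs. z - of_real a)"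
    unfolding of_real_hom.char_poly_hom[OF D] charD by (rule map_poly_real_linear_factors)
  then have "z = 0 \<or> (\<exists>a\<in>set rs. z = of_real a)"
    using root by (auto simp: prod_list_zero_iff)
  moreover have "\<bar>a\<bar> \<le> l" if a: "a \<in> set rs" for a
  proof -
    have ds: "mset ds = add_mset d (mset rs)" unfolding ds_def proots perm by simp
    have len_ds: "length ds = n" using arg_cong[OF ds, of size] arg_cong[OF perm, of size] len by simp
    have sorted: "sorted (rev ds)" by (simp add: ds_def)
    have desc: "ds ! j \<le> ds ! i" if "i \<le> j" "j < n" for i j
      using sorted that by (intro sorted_rev_nth_mono) (auto simp: len_ds)
    have le_d: "b \<le> d" if "b \<in> set ds" for b
    proof -
      have "set ds = set as" using ds perm by (metis set_mset_mset)
      then have "poly (char_poly M) b = 0"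
        using that unfolding as by (auto simp: poly_prod_list prod_list_zero_iff)
      then show ?thesis using eigenvalue_le_row_sum[OF M nn rows] by fastforce
    qed
    obtain x ds' where x: "ds = x # ds'" using len_ds n by (cases ds) auto
    have "d \<in> set ds" using ds by (metis set_mset_mset union_single_eq_member)
    then obtain i where "i < n" "ds ! i = d" by (auto simp: in_set_conv_nth len_ds)
    then have "d \<le> x" using desc[of 0 i] x by simp
    then have "x = d" using le_d[of x] x by simp
    then have "mset ds' = mset rs" using ds x by simp
    then have "a \<in> set ds'" using a by (metis set_mset_mset)
    then obtain i where i: "i < length ds'" "ds' ! i = a" by (auto simp: in_set_conv_nth)
    have "a = ds ! Suc i" "Suc i < n" using i x len_ds by auto
    then have "a \<le> ds ! 1" "ds ! (n - 1) \<le> a" using desc[of 1 "Suc i"] desc[of "Suc i" "n - 1"] by auto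
    then show ?thesis using second by linarith
  qed
  ultimately show ?thesis using l by auto
qed


text \<open>
  A matrix of spectral radius less than 1 has bounded powers.
\<close>

lemma scaled_powers_bounded:
  fixes D :: "real mat"
  assumes D: "D \<in> carrier_mat n n" and l: "0 \<le> l" "l < l'" and n: "n > 0"
    and roots: "\<And>z. poly (char_poly (map_mat complex_of_real D)) z = 0 \<Longrightarrow> cmod z \<le> l"
  shows "\<exists>c. \<forall>k. norm_bound (map_mat (\<lambda>x. complex_of_real (x / l')) D ^\<^sub>m k) c"
proof (rule spectral_radius_jnf_norm_bound_less_1_upper_triangular)
  let ?C = "map_mat (\<lambda>x. complex_of_real (x / l')) D"
  let ?D = "map_mat complex_of_real D"
  show C: "?C \<in> carrier_mat n n" using D by simp
  have DC: "?D \<in> carrier_mat n n" using D by simp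
  obtain z where z: "z \<in> spectrum ?C" "spectral_radius ?C = cmod z"
    using spectral_radius_mem_max(1)[OF C n] by auto
  then obtain v where v: "v \<in> carrier_vec n" "v \<noteq> 0\<^sub>v n" "?C *\<^sub>v v = z \<cdot>\<^sub>v v"
    using D by (auto simp: spectrum_def eigenvalue_def eigenvector_def)
  have "of_real l' \<cdot>\<^sub>v (?C *\<^sub>v v) = ?D *\<^sub>v v"
    using l D v(1) by (intro eq_vecI) (auto simp: scalar_prod_def sum_distrib_left intro!: sum.cong)
  then have "?D *\<^sub>v v = (of_real l' * z) \<cdot>\<^sub>v v" using v by (simp add: smult_smult_assoc)
  then have "eigenvalue ?D (of_real l' * z)"
    using v D by (auto simp: eigenvalue_def eigenvector_def)
  then have "cmod (of_real l' * z) \<le> l" using roots eigenvalue_root_char_poly[OF DC] by blast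
  then have "l' * cmod z \<le> l" using l by (simp add: norm_mult)
  then have "l' * cmod z < l' * 1" using l by linarith
  then have "cmod z < 1" using l by (simp only: mult_less_cancel_left_pos)
  then show "spectral_radius ?C < 1" using z by simp
qed

text \<open>
  For a symmetric matrix a bound on the eigenvalues bounds the norm, by comparing growth rates: if
  $\|E f\| > l \|f\|$, then by log-convexity $\|E^j f\|$ grows at least like the powers of
  some number larger than $l$, whereas the entries of $E^j$ grow no faster than the powers of any
  number larger than $l$.
\<close>

lemma spectral_bound_of_roots:
  fixes xs :: "'v list" and E :: "'v \<Rightarrow> 'v \<Rightarrow> real"
  assumes xs: "distinct xs" "set xs = V" and sym: "\<And>x y. E x y = E y x"
    and l: "l \<ge> 0"
  defines "D \<equiv> mat (length xs) (length xs) (\<lambda>(i, j). E (xs ! i) (xs ! j))"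
  assumes roots: "\<And>z. poly (char_poly (map_mat complex_of_real D)) z = 0 \<Longrightarrow> cmod z \<le> l"
  shows "inner_on V (act V E f) (act V E f) \<le> l\<^sup>2 * inner_on V f f"
proof (rule ccontr)
  assume neg: "\<not> ?thesis"
  define n where "n = length xs"
  define b where "b j = inner_on V ((act V E ^^ j) f) ((act V E ^^ j) f)" for j
  have reindex: "(\<Sum>y\<in>V. F y) = (\<Sum>j<n. F (xs ! j))" for F :: "'v \<Rightarrow> 'a::comm_monoid_add"
    by (rule sum.reindex_bij_betw[symmetric, OF bij_betw_nth[OF xs(1)]]) (simp_all add: n_def xs(2))
  have b1: "b 1 > l\<^sup>2 * b 0" using neg by (simp add: b_def)
  have b_nn: "b j \<ge> 0" for j by (simp add: b_def inner_on_nonneg)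
  have lc: "(b (Suc j))\<^sup>2 \<le> b j * b (Suc (Suc j))" for j
    unfolding b_def by (rule moment_log_convex) (rule sym)
  have b0: "b 0 > 0"
  proof (rule ccontr)
    assume "\<not> b 0 > 0"
    then have "b 0 = 0" using b_nn[of 0] by simp
    then have "b 1 = 0" using lc[of 0] by simp
    then show False using b1 \<open>b 0 = 0\<close> by simp
  qed
  have n: "n > 0"
  proof (rule ccontr)
    assume "\<not> n > 0"
    then have "b 0 = 0" by (simp add: b_def inner_on_def reindex)
    then show False using b0 by simp
  qed
  define q where "q = b 1 / b 0"
  have q: "q > l\<^sup>2" "b 1 = q * b 0" using b1 b0 by (simp_all add: q_def field_simps)
  \<comment> \<open>Any number strictly between $l^2$ and the growth rate $q$ would do.\<close>
  define c where "c = (q + l\<^sup>2) / 2"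
  have c: "l\<^sup>2 < c" "c < q" using q by (simp_all add: c_def)
  have cpos: "c > 0" using c zero_le_power2[of l] by linarith
  define l' where "l' = sqrt c"
  have l': "l < l'" "l'\<^sup>2 = c" "l' > 0"
    using c l cpos real_less_rsqrt[of l c] by (simp_all add: l'_def)
  define C where "C = map_mat (\<lambda>x. complex_of_real (x / l')) D"
  have D: "D \<in> carrier_mat n n" by (simp add: D_def n_def)
  have C: "C \<in> carrier_mat n n" using D by (simp add: C_def)
  obtain K where K: "\<And>k. norm_bound (C ^\<^sub>m k) K"
    using scaled_powers_bounded[OF D l l'(1) n roots] by (auto simp: C_def)
  have repr: "complex_of_real ((act V E ^^ k) g (xs ! i))
      = of_real (l' ^ k) * (\<Sum>j<n. (C ^\<^sub>m k) $$ (i, j) * of_real (g (xs ! j)))" if i: "i < n" for k g i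
  proof (induction k arbitrary: g)
    case 0
    have "(\<Sum>j<n. (C ^\<^sub>m 0) $$ (i, j) * complex_of_real (g (xs ! j)))
        = (\<Sum>j<n. if i = j then complex_of_real (g (xs ! j)) else 0)"
      using i C by (intro sum.cong refl) auto
    then show ?case using i by simp
  next
    case (Suc k)
    have step: "complex_of_real (act V E g (xs ! m)) = of_real l' * (\<Sum>j<n. C $$ (m, j) * of_real (g (xs ! j)))"
      if "m < n" for m
      using that l' by (simp add: act_def reindex C_def D_def n_def sum_distrib_left)
    have Ck: "C ^\<^sub>m k \<in> carrier_mat n n" using C by simp
    have entry: "(C ^\<^sub>m Suc k) $$ (i, j) = (\<Sum>m<n. (C ^\<^sub>m k) $$ (i, m) * C $$ (m, j))" if "j < n" for j
      using i that C Ck by (simp add: scalar_prod_def atLeast0LessThan)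
    have "complex_of_real ((act V E ^^ Suc k) g (xs ! i)) = complex_of_real ((act V E ^^ k) (act V E g) (xs ! i))"
      by (simp only: funpow_shift)
    also have "\<dots> = of_real (l' ^ k) * (\<Sum>m<n. (C ^\<^sub>m k) $$ (i, m) * of_real (act V E g (xs ! m)))"
      by (rule Suc)
    also have "(\<Sum>m<n. (C ^\<^sub>m k) $$ (i, m) * complex_of_real (act V E g (xs ! m)))
      = (\<Sum>m<n. \<Sum>j<n. of_real l' * ((C ^\<^sub>m k) $$ (i, m) * C $$ (m, j) * of_real (g (xs ! j))))"
      by (intro sum.cong refl) (simp add: step sum_distrib_left algebra_simps)
    also have "\<dots> = (\<Sum>j<n. \<Sum>m<n. of_real l' * ((C ^\<^sub>m k) $$ (i, m) * C $$ (m, j) * of_real (g (xs ! j))))"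
      by (rule sum.swap)
    also have "\<dots> = of_real l' * (\<Sum>j<n. (C ^\<^sub>m Suc k) $$ (i, j) * of_real (g (xs ! j)))"
      unfolding sum_distrib_left by (intro sum.cong refl) (simp add: entry sum_distrib_left sum_distrib_right algebra_simps
          del: pow_mat.simps)
    finally show ?case by (simp add: mult.assoc mult.left_commute del: pow_mat.simps)
  qed
  define F where "F = (\<Sum>j<n. \<bar>f (xs ! j)\<bar>)"
  have pointwise: "\<bar>(act V E ^^ k) f (xs ! i)\<bar> \<le> l' ^ k * (K * F)" if i: "i < n" for k i
  proof -
    have "\<bar>(act V E ^^ k) f (xs ! i)\<bar> = cmod (complex_of_real ((act V E ^^ k) f (xs ! i)))" by simp
    also have "\<dots> = l' ^ k * cmod (\<Sum>j<n. (C ^\<^sub>m k) $$ (i, j) * of_real (f (xs ! j)))"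
      unfolding repr[OF i] using l' by (simp add: norm_mult norm_power)
    also have "cmod (\<Sum>j<n. (C ^\<^sub>m k) $$ (i, j) * of_real (f (xs ! j))) \<le> (\<Sum>j<n. K * \<bar>f (xs ! j)\<bar>)"
    proof (rule sum_norm_le)
      fix j assume "j \<in> {..<n}"
      then have "cmod ((C ^\<^sub>m k) $$ (i, j)) \<le> K"
        using K[of k] i C pow_carrier_mat[OF C, of k] by (auto simp: norm_bound_def)
      then show "cmod ((C ^\<^sub>m k) $$ (i, j) * of_real (f (xs ! j))) \<le> K * \<bar>f (xs ! j)\<bar>"
        by (simp add: norm_mult mult_right_mono)
    qed
    finally show ?thesis using l' by (simp add: F_def sum_distrib_left mult_left_mono)
  qed
  have upper: "b k \<le> c ^ k * (real n * (K * F)\<^sup>2)" for k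
  proof -
    have "b k = (\<Sum>i<n. ((act V E ^^ k) f (xs ! i))\<^sup>2)"
      by (simp add: b_def inner_on_def reindex power2_eq_square)
    also have "\<dots> \<le> (\<Sum>i<n. (l' ^ k * (K * F))\<^sup>2)"
    proof (rule sum_mono)
      fix i assume "i \<in> {..<n}"
      then have "\<bar>(act V E ^^ k) f (xs ! i)\<bar> \<le> l' ^ k * (K * F)" using pointwise by simp
      then show "((act V E ^^ k) f (xs ! i))\<^sup>2 \<le> (l' ^ k * (K * F))\<^sup>2"
        by (metis abs_ge_zero power2_abs power_mono)
    qed
    also have "\<dots> = c ^ k * (real n * (K * F)\<^sup>2)"
      by (simp add: power_mult_distrib power_mult[symmetric] mult.commute[of k] flip: l'(2))
    finally show ?thesis .
  qed
  have q0: "q \<ge> 0" using c cpos by linarith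
  have "q ^ k * b 0 \<le> b k" for k
    using log_convex_growth[of b q k, OF b_nn lc _ q0] q(2) by simp
  then have "q ^ k * b 0 \<le> c ^ k * (real n * (K * F)\<^sup>2)" for k using upper[of k] by (rule order_trans)
  then have "(q / c) ^ k * b 0 \<le> real n * (K * F)\<^sup>2" for k
    using cpos by (simp add: power_divide divide_le_eq mult.commute)
  then have "(q / c) ^ k \<le> real n * (K * F)\<^sup>2 / b 0" for k using b0 by (simp add: pos_le_divide_eq)
  moreover have "q / c > 1" using c cpos by simp
  then obtain k where "(q / c) ^ k > real n * (K * F)\<^sup>2 / b 0" using real_arch_pow by blast
  ultimately show False by (metis not_le)
qed

section \<open>Graphs as kernels\<close>

definition kernel :: "'v graph \<Rightarrow> 'v \<Rightarrow> 'v \<Rightarrow> real" where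
  "kernel G x y = (if {x, y} \<in> edges G then 1 else 0)"

lemma kernel_sym: "kernel G x y = kernel G y x"
  by (simp add: kernel_def insert_commute)

lemma sum_kernel:
  assumes G: "simple_graph G" and V: "finite V" "verts G \<subseteq> V"
  shows "(\<Sum>y\<in>V. kernel G x y) = real (degree_in G x)"
proof -
  have "{e \<in> edges G. x \<in> e} = (\<lambda>y. {x, y}) ` {y \<in> V. {x, y} \<in> edges G}" (is "?L = ?R")
  proof (intro equalityI subsetI)
    fix e assume e: "e \<in> ?L"
    then have "card e = 2" "e \<subseteq> V" using G V by (auto simp: simple_graph_def)
    then obtain y where "e = {x, y}" using e by (auto simp: card_2_iff)
    then show "e \<in> ?R" using e \<open>e \<subseteq> V\<close> by auto
  qed auto
  moreover have "inj_on (\<lambda>y. {x, y}) {y \<in> V. {x, y} \<in> edges G}"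
    by (auto simp: inj_on_def doubleton_eq_iff)
  ultimately have "degree_in G x = card {y \<in> V. {x, y} \<in> edges G}"
    by (simp add: degree_in_def card_image)
  also have "real \<dots> = (\<Sum>y\<in>V. kernel G x y)"
    using V by (simp add: kernel_def sum.If_cases Int_def)
  finally show ?thesis ..
qed

lemma finite_edges: "simple_graph G \<Longrightarrow> finite (edges G)"
  by (rule finite_subset[of _ "Pow (verts G)"]) (auto simp: simple_graph_def)

lemma handshake:
  assumes G: "simple_graph G" and V: "finite V" "verts G \<subseteq> V"
  shows "(\<Sum>x\<in>V. real (degree_in G x)) = 2 * real (card (edges G))"
proof -
  have "(\<Sum>x\<in>V. degree_in G x) = (\<Sum>x\<in>V. \<Sum>e\<in>edges G. if x \<in> e then 1 else 0)"
    using finite_edges[OF G] by (simp add: degree_in_def sum.If_cases Int_def)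
  also have "\<dots> = (\<Sum>e\<in>edges G. \<Sum>x\<in>V. if x \<in> e then 1 else 0)" by (rule sum.swap)
  also have "\<dots> = (\<Sum>e\<in>edges G. 2)"
  proof (rule sum.cong[OF refl])
    fix e assume "e \<in> edges G"
    then have "e \<subseteq> V" "card e = 2" using G V by (auto simp: simple_graph_def)
    then show "(\<Sum>x\<in>V. if x \<in> e then 1 else 0) = (2::nat)"
      using V by (simp add: sum.If_cases Int_absorb1)
  qed
  finally show ?thesis by (simp flip: of_nat_sum)
qed

lemma ndl_graph_pseudorandom:
  assumes G: "ndl_graph n d l G" and pos: "n > 0" "d > 0" "l > 0"
  shows "pseudorandom (verts G) (kernel G) (real d) l"
proof
  have simple: "simple_graph G" and card: "card (verts G) = n" and reg: "regular_graph G d"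
    and second: "\<bar>second_eigenvalue G\<bar> \<le> l" using G by (auto simp: ndl_graph_def)
  show fin: "finite (verts G)" using simple by (simp add: simple_graph_def)
  show "verts G \<noteq> {}" using card pos(1) by (metis card.empty less_irrefl)
  show "kernel G x y = kernel G y x" for x y by (rule kernel_sym)
  show "kernel G x y \<in> {0, 1}" for x y by (simp add: kernel_def)
  show rows: "(\<Sum>y\<in>verts G. kernel G x y) = real d" if "x \<in> verts G" for x
    using sum_kernel[OF simple fin] reg that by (simp add: regular_graph_def)
  show "real d > 0" "l > 0" using pos by auto
  fix f :: "'a \<Rightarrow> real"
  define xs where "xs = vertex_list G"
  have "distinct xs \<and> set xs = verts G"
    unfolding xs_def vertex_list_def by (rule someI_ex) (use finite_distinct_list[OF fin] in blast)
  then have xs: "distinct xs" "set xs = verts G" by (rule conjunct1, rule conjunct2)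
  have len: "length xs = n" using distinct_card[OF xs(1)] unfolding xs(2) card by (rule sym)
  have nth: "xs ! i \<in> verts G" if "i < n" for i
    using that nth_mem[of i xs] unfolding xs(2) len by blast
  have reindex: "(\<Sum>y\<in>verts G. F y) = (\<Sum>j<n. F (xs ! j))" for F :: "'a \<Rightarrow> real"
    by (rule sum.reindex_bij_betw[symmetric, OF bij_betw_nth[OF xs(1)]]) (simp_all add: len xs(2))
  let ?M = "adj_matrix G"
  have M: "?M \<in> carrier_mat n n" by (simp add: adj_matrix_def card)
  have entry: "?M $$ (i, j) = kernel G (xs ! i) (xs ! j)" if "i < n" "j < n" for i j
    using that by (simp add: adj_matrix_def card kernel_def xs_def)
  have D: "mat (length xs) (length xs) (\<lambda>(i, j). mean_free (verts G) (real d) (kernel G) (xs ! i) (xs ! j))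
      = mat n n (\<lambda>(i, j). ?M $$ (i, j) - real d / real n)"
    by (intro eq_matI) (auto simp: len mean_free_def card entry)
  show "inner_on (verts G) (act (verts G) (mean_free (verts G) (real d) (kernel G)) f)
            (act (verts G) (mean_free (verts G) (real d) (kernel G)) f) \<le> l\<^sup>2 * inner_on (verts G) f f"
  proof (rule spectral_bound_of_roots[OF xs])
    show "mean_free (verts G) (real d) (kernel G) x y = mean_free (verts G) (real d) (kernel G) y x" for x y
      by (simp add: mean_free_def kernel_sym)
    show "l \<ge> 0" using pos by simp
    fix z
    assume z: "poly (char_poly (map_mat complex_of_real (mat (length xs) (length xs)
      (\<lambda>(i, j). mean_free (verts G) (real d) (kernel G) (xs ! i) (xs ! j))))) z = 0"
    show "cmod z \<le> l"
    proof (rule deflated_eigenvalue_bound[OF M])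
      show "?M $$ (i, j) = ?M $$ (j, i)" if "i < n" "j < n" for i j
        using that by (simp add: entry kernel_sym)
      show "?M $$ (i, j) \<ge> 0" if "i < n" "j < n" for i j using that by (simp add: entry kernel_def)
      show "(\<Sum>j<n. ?M $$ (i, j)) = real d" if "i < n" for i
        using that rows[OF nth[OF that]] by (simp add: entry reindex)
      show "max (rev (sorted_list_of_multiset (proots (char_poly ?M))) ! 1)
          \<bar>rev (sorted_list_of_multiset (proots (char_poly ?M))) ! (n - 1)\<bar> \<le> l"
        using second card by (simp add: second_eigenvalue_def graph_eigenvalue_def eigenvalue_list_def)
    qed (use z pos in \<open>simp_all add: D\<close>)
  qed
qed


section \<open>Counting edges without an odd cycle\<close>

context pseudorandom begin

lemma degree_le_card: "d \<le> n"
proof -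
  obtain x where x: "x \<in> V" using nonempty by auto
  have "d = (\<Sum>y\<in>V. A x y)" using regular[OF x] by simp
  also have "\<dots> \<le> (\<Sum>y\<in>V. 1)" using zero_one[of x] by (intro sum_mono) (metis insertE le_numeral_extra(4) singletonD zero_le_one)
  finally show ?thesis by simp
qed

text \<open>
  After division by $d^{2j+3}$ the product of the two walk counts, summed over the vertices, is at
  most $1/n + 2/d + n \<rho>^{2j-1}/d^2$ unless one of the two lengths is 1, in which case there is no
  closed walk. If $2d \<le> n$, then \<open>lam_lower\<close> gives $1/d \<le> 2 \<rho>^2$, which turns the last
  two terms into multiples of $\<rho>^2$ and of $n \<rho>^{2j+1}/d$, the quantity that the hypothesis on
  $\<lambda>$ makes small; if $2d > n$, both are of order $1/n$.
\<close>

lemma closed_walk_product_bound: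
  assumes loopless: "A y y = 0" and y: "y \<in> V" and lam_le: "lam \<le> d"
    and pq: "p \<ge> 1" "q \<ge> 1" "p + q = 2 * j + 3"
  defines "\<rho> \<equiv> lam / d"
  shows "n * ((act V A ^^ p) (point_mass y) y * (act V A ^^ q) (point_mass y) y)
           \<le> d ^ (2 * j + 3) * (9 / n + 4 * \<rho>\<^sup>2 + 2 * (n * \<rho> ^ (2 * j + 1) / d))"
proof -
  have \<rho>: "0 \<le> \<rho>" "\<rho> \<le> 1" "lam = \<rho> * d" using lam_pos d_pos lam_le by (simp_all add: \<rho>_def)
  let ?r = "n * \<rho> ^ (2 * j + 1) / d"
  have r_nn: "?r \<ge> 0" using \<rho> n_pos d_pos by simp
  have rhs_nn: "0 \<le> d ^ (2 * j + 3) * (9 / n + 4 * \<rho>\<^sup>2 + 2 * ?r)"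
    using r_nn d_pos n_pos by (intro mult_nonneg_nonneg add_nonneg_nonneg) auto
  have one: "(act V A ^^ 1) (point_mass y) y = 0" using loopless y fin by (simp add: act_point_mass)
  show ?thesis
  proof (cases "p = 1 \<or> q = 1")
    case True
    then show ?thesis using one rhs_nn by auto
  next
    case False
    then obtain a b where ab: "p = a + 2" "q = b + 2" using pq
      by (metis One_nat_def Suc_1 Suc_leI add.commute le_Suc_ex le_neq_implies_less)
    then have j: "j \<ge> 1" and sum_ab: "a + b = 2 * j - 1" using pq by auto
    have \<rho>_pow: "0 \<le> \<rho> ^ i" "\<rho> ^ i \<le> 1" for i using \<rho> by (simp_all add: power_le_one)
    have walk: "(act V A ^^ (i + 2)) (point_mass y) y \<le> d ^ (i + 2) * (1 / n + \<rho> ^ i / d)" for i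
    proof -
      have "lam ^ i * d = d ^ (i + 2) * (\<rho> ^ i / d)"
        using d_pos by (simp add: \<rho>(3) power_mult_distrib)
      then show ?thesis using closed_walks_at[OF y, of i] by (simp add: distrib_left)
    qed
    have walk_nn: "(act V A ^^ i) (point_mass y) y \<ge> 0" for i
      by (intro act_power_nonneg A_nonneg point_mass_nonneg)
    have "(act V A ^^ p) (point_mass y) y * (act V A ^^ q) (point_mass y) y
        \<le> (d ^ (a + 2) * (1 / n + \<rho> ^ a / d)) * (d ^ (b + 2) * (1 / n + \<rho> ^ b / d))"
      unfolding ab using \<rho>_pow n_pos d_pos
      by (intro mult_mono walk walk_nn mult_nonneg_nonneg add_nonneg_nonneg) auto
    also have "\<dots> = d ^ (2 * j + 3) * ((1 / n + \<rho> ^ a / d) * (1 / n + \<rho> ^ b / d))"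
    proof -
      have "d ^ (2 * j + 3) = d ^ (a + 2) * d ^ (b + 2)"
        unfolding power_add[symmetric] using sum_ab j by (intro arg_cong[of _ _ "\<lambda>i. d ^ i"]) simp
      then show ?thesis by (simp only: mult.assoc mult.left_commute)
    qed
    finally have "n * ((act V A ^^ p) (point_mass y) y * (act V A ^^ q) (point_mass y) y)
        \<le> n * (d ^ (2 * j + 3) * ((1 / n + \<rho> ^ a / d) * (1 / n + \<rho> ^ b / d)))"
      using n_pos by (intro mult_left_mono) auto
    also have "\<dots> = d ^ (2 * j + 3) * (n * ((1 / n + \<rho> ^ a / d) * (1 / n + \<rho> ^ b / d)))"
      by (simp only: mult.left_commute)
    also have "\<dots> \<le> d ^ (2 * j + 3) * (9 / n + 4 * \<rho>\<^sup>2 + 2 * ?r)"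
    proof (rule mult_left_mono)
      have "n * ((1 / n + \<rho> ^ a / d) * (1 / n + \<rho> ^ b / d))
            = 1 / n + (\<rho> ^ a + \<rho> ^ b) * (1 / d) + n * \<rho> ^ (2 * j - 1) / d\<^sup>2"
        unfolding sum_ab[symmetric] power_add using n_pos d_pos by (simp add: field_simps power2_eq_square)
      moreover have "(\<rho> ^ a + \<rho> ^ b) * (1 / d) \<le> 2 * (1 / d)"
        using \<rho>_pow(2)[of a] \<rho>_pow(2)[of b] d_pos by (intro mult_right_mono) auto
      moreover have "1 / d \<le> 2 * \<rho>\<^sup>2 + 2 / n \<and> n * \<rho> ^ (2 * j - 1) / d\<^sup>2 \<le> 2 * ?r + 4 / n"
      proof (cases "2 * d \<le> n")
        case True
        have "d\<^sup>2 / n \<le> d / 2" using True d_pos n_pos by (simp add: field_simps power2_eq_square)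
        then have "d / 2 \<le> lam\<^sup>2" using lam_lower by linarith
        then have "d \<le> 2 * \<rho>\<^sup>2 * d\<^sup>2" by (simp add: \<rho>(3) power_mult_distrib)
        then have low: "1 / d \<le> 2 * \<rho>\<^sup>2" using d_pos by (simp add: field_simps power2_eq_square)
        have "n * \<rho> ^ (2 * j - 1) / d\<^sup>2 = n * \<rho> ^ (2 * j - 1) / d * (1 / d)"
          by (simp add: power2_eq_square)
        also have "\<dots> \<le> n * \<rho> ^ (2 * j - 1) / d * (2 * \<rho>\<^sup>2)"
          using low \<rho> n_pos d_pos by (intro mult_left_mono) auto
        also have "\<dots> = 2 * (n * (\<rho> ^ (2 * j - 1) * \<rho>\<^sup>2) / d)" by simp
        also have "\<rho> ^ (2 * j - 1) * \<rho>\<^sup>2 = \<rho> ^ (2 * j + 1)"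
          unfolding power_add[symmetric] using j by (intro arg_cong[of _ _ "\<lambda>i. \<rho> ^ i"]) simp
        finally have "n * \<rho> ^ (2 * j - 1) / d\<^sup>2 \<le> 2 * ?r" .
        moreover have "0 \<le> 2 / n" "0 \<le> 4 / n" using n_pos by auto
        ultimately show ?thesis using low by linarith
      next
        case False
        then have big: "n \<le> 2 * d" by simp
        have inv: "1 / d \<le> 2 / n" using big d_pos n_pos by (simp add: field_simps)
        have "n * \<rho> ^ (2 * j - 1) / d\<^sup>2 \<le> n * 1 / d\<^sup>2"
          using \<rho>_pow n_pos by (intro divide_right_mono mult_left_mono) auto
        also have "\<dots> = n * ((1 / d) * (1 / d))" by (simp add: power2_eq_square)
        also have "\<dots> \<le> n * ((2 / n) * (2 / n))"
          using inv n_pos d_pos by (intro mult_left_mono mult_mono) auto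
        also have "\<dots> = 4 / n" using n_pos by simp
        finally have "n * \<rho> ^ (2 * j - 1) / d\<^sup>2 \<le> 4 / n" .
        then show ?thesis using inv r_nn zero_le_power2[of \<rho>] by linarith
      qed
      ultimately show "n * ((1 / n + \<rho> ^ a / d) * (1 / n + \<rho> ^ b / d)) \<le> 9 / n + 4 * \<rho>\<^sup>2 + 2 * ?r"
        by (simp add: add_divide_distrib[symmetric])
    qed (use d_pos in simp)
    finally show ?thesis .
  qed
qed

end

text \<open>
  The quantities $\<rho>$ and $r$ are the relative sizes of the two terms of
  $\<lambda>\,\mathrm{tr}(A^{2k})$ for $k = j+1$; all error terms are expressed through them
  and $1/n$.
\<close>

lemma (in pseudorandom_sub) few_edges_without_cycle:
  fixes j :: nat
  defines "\<rho> \<equiv> lam / d" and "r \<equiv> n * lam ^ (2 * j + 1) / d ^ (2 * j + 2)"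
  assumes loopless: "\<And>x. A x x = 0" and lam_le: "lam \<le> d"
    and cycle_free: "\<And>ws. distinct ws \<Longrightarrow> length ws = 2 * j + 3 \<Longrightarrow> cycle_weight B ws = 0"
  shows "(\<Sum>x\<in>V. \<Sum>y\<in>V. B x y)
    \<le> n * d * (1 / 2 + 4 ^ j * (3 * (\<rho> + r) + (real (2 * j + 3))\<^sup>2 * (9 / n + 4 * \<rho>\<^sup>2 + 2 * r)))"
proof -
  define m where "m = 2 * j + 3"
  define S where "S = (\<Sum>x\<in>V. inner_on V ((act V A ^^ Suc j) (point_mass x)) ((act V A ^^ Suc j) (point_mass x)))"
  define t where "t = (\<Sum>x\<in>V. Bpow m (point_mass x) x)"
  define \<eta> where "\<eta> = 9 / n + 4 * \<rho>\<^sup>2 + 2 * r"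
  have \<rho>: "lam = \<rho> * d" "\<rho> \<ge> 0" using d_pos lam_pos by (simp_all add: \<rho>_def)
  have r: "r = n * \<rho> ^ (2 * j + 1) / d" using d_pos by (simp add: r_def \<rho>_def power_divide)
  have r_nn: "r \<ge> 0" using \<rho> d_pos n_pos by (simp add: r)
  have \<eta>_nn: "\<eta> \<ge> 0" using r_nn n_pos by (simp add: \<eta>_def)
  have t_le: "t \<le> (real m)\<^sup>2 * (d ^ m * \<eta>)"
  proof -
    have fin_m: "finite (seqs V m)" by (rule finite_seqs[OF fin])
    have "t = (\<Sum>ws\<in>seqs V m. cycle_weight B ws)"
      unfolding t_def m_def using sum_cycle_weight[OF fin, of B "2 * j + 2"] by (simp add: eval_nat_numeral del: funpow.simps)
    also have "\<dots> = (\<Sum>ws\<in>{ws\<in>seqs V m. \<not> distinct ws}. cycle_weight B ws)"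
      using fin_m cycle_free by (intro sum.mono_neutral_right) (auto simp: seqs_def m_def)
    also have "\<dots> \<le> (\<Sum>ws\<in>{ws\<in>seqs V m. \<not> distinct ws}. cycle_weight A ws)"
      using B_nonneg B_le by (intro sum_mono cycle_weight_mono) auto
    also have "\<dots> \<le> (real m)\<^sup>2 * n * (d ^ m * \<eta> / n)"
    proof (rule sum_nondistinct_cycle_weight[OF fin A_nonneg])
      fix y p q assume "y \<in> V" "p \<ge> 1" "q \<ge> 1" "p + q = m"
      then have "n * ((act V A ^^ p) (point_mass y) y * (act V A ^^ q) (point_mass y) y) \<le> d ^ m * \<eta>"
        unfolding m_def \<eta>_def r \<rho>_def by (intro closed_walk_product_bound loopless lam_le)
      then show "(act V A ^^ p) (point_mass y) y * (act V A ^^ q) (point_mass y) y \<le> d ^ m * \<eta> / n"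
        using n_pos by (simp add: pos_le_divide_eq mult.commute)
    qed (use d_pos \<eta>_nn n_pos in simp)
    finally show ?thesis using n_pos by simp
  qed
  have S_le: "S \<le> d ^ (2 * j + 2) + n * d * lam ^ (2 * j)"
    unfolding S_def by (rule closed_walks_total)
  define T where "T = 3 * lam * (d ^ (2 * j + 2) + n * d * lam ^ (2 * j)) + (real m)\<^sup>2 * (d ^ m * \<eta>)"
  have T_nn: "T \<ge> 0"
    unfolding T_def using lam_pos d_pos n_pos \<eta>_nn by (intro add_nonneg_nonneg mult_nonneg_nonneg) auto
  have "2 * (d / n) * moment (2 * j + 2) \<le> d\<^sup>2 / n * moment (2 * j + 1) + 3 * lam * S + t"
    unfolding S_def t_def m_def by (rule walk_inequality)
  also have "\<dots> \<le> d\<^sup>2 / n * moment (2 * j + 1) + T"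
  proof -
    have "3 * lam * S \<le> 3 * lam * (d ^ (2 * j + 2) + n * d * lam ^ (2 * j))"
      using S_le lam_pos by (intro mult_left_mono) auto
    then show ?thesis using t_le unfolding T_def by linarith
  qed
  finally have "moment 1 \<le> n * d * (1 / 2 + 4 ^ j * T / d ^ (2 * j + 3))"
    using T_nn by (rule density_bound)
  moreover have "T = d ^ m * (3 * (\<rho> + r) + (real m)\<^sup>2 * \<eta>)"
  proof -
    have "3 * lam * (d ^ (2 * j + 2) + n * d * lam ^ (2 * j)) = d ^ m * (3 * (\<rho> + r))"
    proof -
      have e: "d ^ m = d * d ^ (2 * j + 2)" by (simp add: m_def eval_nat_numeral)
      have "d ^ m * \<rho> = lam * d ^ (2 * j + 2)" by (simp add: e \<rho>(1))
      moreover have "d ^ m * r = n * d * lam ^ (2 * j + 1)" using d_pos by (simp add: e r_def)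
      ultimately show ?thesis by (simp add: algebra_simps)
    qed
    then show ?thesis unfolding T_def by (simp add: algebra_simps)
  qed
  moreover have "moment 1 = (\<Sum>x\<in>V. \<Sum>y\<in>V. B x y)"
    by (simp add: moment_def inner_on_def act_def)
  ultimately show ?thesis using d_pos by (simp add: m_def \<eta>_def)
qed

lemma cycle_weight_cycle_free:
  assumes H: "simple_graph H" and free: "\<not> contains_copy H (cycle_graph m)"
    and ws: "distinct ws" "length ws = m"
  shows "cycle_weight (kernel H) ws = 0"
proof (rule ccontr)
  assume nz: "cycle_weight (kernel H) ws \<noteq> 0"
  have edge: "{ws ! i, ws ! (Suc i mod m)} \<in> edges H" if "i < m" for i
    using cycle_weight_nth[OF nz, of i] that ws by (auto simp: kernel_def split: if_splits)
  have "inj_on ((!) ws) {..<m}" using ws by (auto simp: inj_on_def nth_eq_iff_index_eq)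
  moreover have "(!) ws ` {..<m} \<subseteq> verts H"
    using edge H by (force simp: simple_graph_def)
  moreover have "(!) ws ` e \<in> edges H" if "e \<in> edges (cycle_graph m)" for e
    using that edge by (auto simp: cycle_graph_def edges_def[of "(_, _)"])
  ultimately have "contains_copy H (cycle_graph m)"
    unfolding contains_copy_def by (intro exI[of _ "(!) ws"]) (simp add: cycle_graph_def verts_def)
  then show False using free by simp
qed

lemma subgraph_edge_bound:
  fixes j :: nat
  assumes G: "ndl_graph n d l G" and pos: "n > 0" "d > 0" "l > 0" and l_le: "l \<le> real d"
    and H: "subgraph_of H G" and free: "\<not> contains_copy H (cycle_graph (2 * j + 3))"
  defines "\<rho> \<equiv> l / real d" and "r \<equiv> real n * l ^ (2 * j + 1) / real d ^ (2 * j + 2)"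
  shows "2 * real (card (edges H)) \<le> real n * real d * (1 / 2 + 4 ^ j *
           (3 * (\<rho> + r) + (real (2 * j + 3))\<^sup>2 * (9 / real n + 4 * \<rho>\<^sup>2 + 2 * r)))"
proof -
  have simple: "simple_graph G" and card: "card (verts G) = n" using G by (auto simp: ndl_graph_def)
  have H': "simple_graph H" "verts H \<subseteq> verts G" "edges H \<subseteq> edges G" using H by (auto simp: subgraph_of_def)
  have fin: "finite (verts G)" using simple by (simp add: simple_graph_def)
  interpret pseudorandom "verts G" "kernel G" "real d" l by (rule ndl_graph_pseudorandom[OF G pos])
  interpret pseudorandom_sub "verts G" "kernel G" "real d" l "kernel H"
    by unfold_locales (use H' in \<open>auto simp: kernel_def insert_commute\<close>)
  have "{x, x} \<notin> edges G" for x using simple by (auto simp: simple_graph_def)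
  then have "kernel G x x = 0" for x by (simp add: kernel_def)
  then have "(\<Sum>x\<in>verts G. \<Sum>y\<in>verts G. kernel H x y) \<le> real n * real d * (1 / 2 + 4 ^ j *
           (3 * (\<rho> + r) + (real (2 * j + 3))\<^sup>2 * (9 / real n + 4 * \<rho>\<^sup>2 + 2 * r)))"
    unfolding \<rho>_def r_def card[symmetric]
    by (intro few_edges_without_cycle l_le cycle_weight_cycle_free[OF H'(1) free])
  then show ?thesis using handshake[OF H'(1) fin H'(2)] sum_kernel[OF H'(1) fin H'(2)] by simp
qed

section \<open>Maximum cuts\<close>

text \<open>
  Vertices are placed one at a time, each on the side that cuts at least half of its edges to the
  vertices placed before.
\<close>

lemma max_cut:
  assumes "finite V" "finite E" "\<And>e. e \<in> E \<Longrightarrow> e \<subseteq> V \<and> card e = 2"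
  shows "\<exists>S\<subseteq>V. card E \<le> 2 * card {e \<in> E. card (e \<inter> S) = 1}"
  using assms
proof (induction V arbitrary: E rule: finite_induct)
  case empty
  then have "E = {}" by fastforce
  then show ?case by auto
next
  case (insert v V)
  define E1 where "E1 = {e \<in> E. v \<notin> e}"
  define E2 where "E2 = {e \<in> E. v \<in> e}"
  have fin: "finite E1" "finite E2" using insert.prems by (auto simp: E1_def E2_def)
  have E: "E = E1 \<union> E2" "E1 \<inter> E2 = {}" by (auto simp: E1_def E2_def)
  have "\<exists>S\<subseteq>V. card E1 \<le> 2 * card {e \<in> E1. card (e \<inter> S) = 1}"
    by (rule insert.IH[OF fin(1)]) (use insert.prems in \<open>auto simp: E1_def\<close>)
  then obtain S where S: "S \<subseteq> V" "card E1 \<le> 2 * card {e \<in> E1. card (e \<inter> S) = 1}" by blast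
  let ?cut = "\<lambda>E S. {e \<in> E. card (e \<inter> S) = 1}"
  have E1_eq: "?cut E1 (insert v S) = ?cut E1 S" by (auto simp: E1_def)
  have "E2 \<subseteq> ?cut E2 S \<union> ?cut E2 (insert v S)"
  proof
    fix e assume e: "e \<in> E2"
    then have "card e = 2" "v \<in> e" using insert.prems by (auto simp: E2_def)
    then obtain w where w: "e = {v, w}" "w \<noteq> v" by (auto simp: card_2_iff)
    have "v \<notin> S" using S insert by auto
    then show "e \<in> ?cut E2 S \<union> ?cut E2 (insert v S)"
      using e w by (cases "w \<in> S") auto
  qed
  then have "card E2 \<le> card (?cut E2 S \<union> ?cut E2 (insert v S))" using fin by (intro card_mono) auto
  also have "\<dots> \<le> card (?cut E2 S) + card (?cut E2 (insert v S))" by (rule card_Un_le)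
  finally have "card E2 \<le> 2 * card (?cut E2 S) \<or> card E2 \<le> 2 * card (?cut E2 (insert v S))"
    by linarith
  then obtain S' where S': "S' = S \<or> S' = insert v S" "card E2 \<le> 2 * card (?cut E2 S')"
    by blast
  have "?cut E S' = ?cut E1 S' \<union> ?cut E2 S'" using E by auto
  then have "card (?cut E S') = card (?cut E1 S') + card (?cut E2 S')"
    using card_Un_disjoint[of "?cut E1 S'" "?cut E2 S'"] fin E(2) by auto
  moreover have "card (?cut E1 S') = card (?cut E1 S)" using S'(1) E1_eq by auto
  moreover have "card E = card E1 + card E2" using card_Un_disjoint[OF fin E(2)] E(1) by simp
  ultimately have "card E \<le> 2 * card (?cut E S')" using S(2) S'(2) by simp
  moreover have "S' \<subseteq> insert v V" using S(1) S'(1) by auto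
  ultimately show ?case by blast
qed

text \<open>
  Along a cycle the vertices alternate between the two sides of the cut, so they return to the
  starting side only after an even number of steps.
\<close>

lemma cut_has_no_odd_cycle:
  assumes E: "\<And>e. e \<in> edges H \<Longrightarrow> card e = 2 \<and> card (e \<inter> S) = 1"
  shows "\<not> contains_copy H (cycle_graph (2 * k + 1))"
proof
  define m where "m = 2 * k + 1"
  assume "contains_copy H (cycle_graph (2 * k + 1))"
  then obtain f where f: "\<forall>e\<in>edges (cycle_graph m). f ` e \<in> edges H"
    by (auto simp: contains_copy_def m_def)
  have alternate: "(f (Suc i mod m) \<in> S) = (f i \<notin> S)" if i: "i < m" for i
  proof -
    have "{i, Suc i mod m} \<in> edges (cycle_graph m)" using i by (auto simp: cycle_graph_def edges_def)
    then have "f ` {i, Suc i mod m} \<in> edges H" using f by blast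
    then have "{f i, f (Suc i mod m)} \<in> edges H" by simp
    then have "card {f i, f (Suc i mod m)} = 2" "card ({f i, f (Suc i mod m)} \<inter> S) = 1"
      using E by auto
    then show ?thesis by (cases "f i \<in> S"; cases "f (Suc i mod m) \<in> S") (auto split: if_splits)
  qed
  have parity: "(f i \<in> S) = ((f 0 \<in> S) = even i)" if "i < m" for i
    using that
  proof (induction i)
    case (Suc i)
    then have "(f (Suc i) \<in> S) = (f i \<notin> S)" using alternate[of i] by simp
    then show ?case using Suc by auto
  qed simp
  show False using parity[of "2 * k"] alternate[of "2 * k"] by (simp add: m_def)
qed

section \<open>The Turan number of an odd cycle\<close>

lemma finite_free_subgraph_sizes:
  assumes "simple_graph G"
  shows "finite {card (edges H) | H. subgraph_of H G \<and> \<not> contains_copy H F}"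
proof (rule finite_subset)
  show "{card (edges H) | H. subgraph_of H G \<and> \<not> contains_copy H F} \<subseteq> {..card (edges G)}"
    using card_mono[OF finite_edges[OF assms]] by (auto simp: subgraph_of_def)
qed simp

lemma ex_num_ge:
  assumes "simple_graph G" "subgraph_of H G" "\<not> contains_copy H F"
  shows "card (edges H) \<le> ex_num G F"
  unfolding ex_num_def
  by (rule Max_ge[OF finite_free_subgraph_sizes[OF assms(1)]]) (use assms in blast)

lemma ex_num_attained:
  assumes "simple_graph G" "subgraph_of H0 G" "\<not> contains_copy H0 F"
  obtains H where "subgraph_of H G" "\<not> contains_copy H F" "ex_num G F = card (edges H)"
proof -
  have "ex_num G F \<in> {card (edges H) | H. subgraph_of H G \<and> \<not> contains_copy H F}"
    unfolding ex_num_def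
    by (rule Max_in[OF finite_free_subgraph_sizes[OF assms(1)]]) (use assms in blast)
  then show thesis using that by blast
qed

lemma bipartite_subgraph:
  assumes G: "simple_graph G"
  obtains H where "subgraph_of H G" "\<not> contains_copy H (cycle_graph (2 * k + 1))"
    "card (edges G) \<le> 2 * card (edges H)"
proof -
  have "\<exists>S\<subseteq>verts G. card (edges G) \<le> 2 * card {e \<in> edges G. card (e \<inter> S) = 1}"
    using G by (intro max_cut finite_edges) (auto simp: simple_graph_def)
  then obtain S where S: "card (edges G) \<le> 2 * card {e \<in> edges G. card (e \<inter> S) = 1}" by blast
  define H where "H = (verts G, {e \<in> edges G. card (e \<inter> S) = 1})"
  have H: "verts H = verts G" "edges H = {e \<in> edges G. card (e \<inter> S) = 1}"
    by (simp_all add: H_def verts_def edges_def)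
  have "subgraph_of H G" using G by (auto simp: subgraph_of_def simple_graph_def H)
  moreover have "\<not> contains_copy H (cycle_graph (2 * k + 1))"
    using G by (intro cut_has_no_odd_cycle[of _ S]) (auto simp: H simple_graph_def)
  ultimately show thesis using that S by (simp add: H)
qed

theorem theorem1:
  fixes k :: nat
    and n d :: "nat \<Rightarrow> nat"
    and lam :: "nat \<Rightarrow> real"
    and \<Gamma> :: "nat \<Rightarrow> 'v graph"
  assumes "k \<ge> 1"
    and "filterlim n at_top sequentially"
    and "\<And>i. d i > 0"
    and "\<And>i. lam i > 0"
    and "\<And>i. ndl_graph (n i) (d i) (lam i) (\<Gamma> i)"
    and "(\<lambda>i. lam i ^ (2 * k - 1)) \<lless>
         (\<lambda>i. real (d i) ^ (2 * k) / real (n i)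
               * ln (real (n i)) powi (- int (2 * (k - 1) * (2 * k - 1))))"
  shows "\<exists>\<epsilon>. \<epsilon> \<longlonglongrightarrow> 0 \<and>
           (\<forall>i. real (ex_num (\<Gamma> i) (cycle_graph (2 * k + 1)))
                 = (1 / 2 + \<epsilon> i) * (real (d i) * real (n i) / 2))"
proof -
  \<comment> \<open>The cycle length is $2j+3$; with $j$ no subtraction of natural numbers is needed.\<close>
  define j where "j = k - 1"
  have k: "k = j + 1" using assms(1) by (simp add: j_def)
  define \<rho> where "\<rho> i = lam i / real (d i)" for i
  define r where "r i = real (n i) * lam i ^ (2 * j + 1) / real (d i) ^ (2 * j + 2)" for i
  define u where "u i = 4 ^ j * (3 * (\<rho> i + r i)
      + (real (2 * j + 3))\<^sup>2 * (9 / real (n i) + 4 * (\<rho> i)\<^sup>2 + 2 * r i))" for i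
  define ex where "ex i = real (ex_num (\<Gamma> i) (cycle_graph (2 * k + 1)))" for i
  define \<epsilon> where "\<epsilon> i = ex i / (real (d i) * real (n i) / 2) - 1 / 2" for i
  have simple: "simple_graph (\<Gamma> i)" and card: "card (verts (\<Gamma> i)) = n i" for i
    using assms(5)[of i] by (auto simp: ndl_graph_def)
  have edges: "2 * real (card (edges (\<Gamma> i))) = real (d i) * real (n i)" for i
  proof -
    have "regular_graph (\<Gamma> i) (d i)" using assms(5)[of i] by (simp add: ndl_graph_def)
    then have "(\<Sum>x\<in>verts (\<Gamma> i). real (degree_in (\<Gamma> i) x)) = real (n i) * real (d i)"
      by (simp add: regular_graph_def card)
    then show ?thesis using handshake[OF simple, of "verts (\<Gamma> i)" i] simple[of i]
      by (simp add: simple_graph_def mult.commute)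
  qed
  have n_large: "eventually (\<lambda>i. n i \<ge> N) sequentially" for N
    using assms(2) by (simp add: filterlim_at_top)
  have r_nn: "r i \<ge> 0" for i using assms(4)[of i] by (simp add: r_def)
  have \<rho>_nn: "\<rho> i \<ge> 0" for i using assms(4)[of i] by (simp add: \<rho>_def)
  \<comment> \<open>The logarithmic factor in the hypothesis is at least 1 as soon as $n \<ge> 3$.\<close>
  have r_lim: "r \<longlonglongrightarrow> 0"
  proof (rule real_tendsto_sandwich[OF _ _ tendsto_const assms(6)[unfolded much_less_def]])
    show "eventually (\<lambda>i. 0 \<le> r i) sequentially" using r_nn by simp
    show "eventually (\<lambda>i. r i \<le> lam i ^ (2 * k - 1) /
         (real (d i) ^ (2 * k) / real (n i)
               * ln (real (n i)) powi (- int (2 * (k - 1) * (2 * k - 1))))) sequentially"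
      using n_large[of 3]
    proof eventually_elim
      case (elim i)
      define L where "L = ln (real (n i))"
      define s where "s = 2 * (k - 1) * (2 * k - 1)"
      have "exp 1 \<le> real (n i)" using elim exp_le by linarith
      then have L: "L \<ge> 1" unfolding L_def using elim by (simp add: ln_ge_iff)
      have "lam i ^ (2 * k - 1) / (real (d i) ^ (2 * k) / real (n i) * L powi (- int s)) = r i * L ^ s"
        by (simp add: r_def k power_int_minus divide_simps)
      moreover have "r i * 1 \<le> r i * L ^ s" using L r_nn by (intro mult_left_mono one_le_power) auto
      ultimately show ?case unfolding L_def s_def by simp
    qed
  qed
  have d_le_n: "eventually (\<lambda>i. d i \<le> n i) sequentially"
    using n_large[of 1]
  proof eventually_elim
    case (elim i)
    interpret pseudorandom "verts (\<Gamma> i)" "kernel (\<Gamma> i)" "real (d i)" "lam i"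
      using elim assms(3,4,5) by (intro ndl_graph_pseudorandom) auto
    show ?case using degree_le_card card by simp
  qed
  \<comment> \<open>$\<rho>^{2j+1} = r d/n \<le> r$, so the hypothesis also forces $\<lambda> \<ll> d$.\<close>
  have "(\<lambda>i. \<rho> i ^ (2 * j + 1)) \<longlonglongrightarrow> 0"
  proof (rule real_tendsto_sandwich[OF _ _ tendsto_const r_lim])
    show "eventually (\<lambda>i. 0 \<le> \<rho> i ^ (2 * j + 1)) sequentially" using \<rho>_nn by simp
    show "eventually (\<lambda>i. \<rho> i ^ (2 * j + 1) \<le> r i) sequentially"
      using d_le_n
    proof eventually_elim
      case (elim i)
      have "r i = real (n i) / real (d i) * \<rho> i ^ (2 * j + 1)"
        using assms(3)[of i] by (simp add: r_def \<rho>_def power_divide)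
      moreover have "1 * \<rho> i ^ (2 * j + 1) \<le> real (n i) / real (d i) * \<rho> i ^ (2 * j + 1)"
        using elim assms(3)[of i] \<rho>_nn by (intro mult_right_mono) auto
      ultimately show ?case by simp
    qed
  qed
  then have "(\<lambda>i. root (2 * j + 1) (\<rho> i ^ (2 * j + 1))) \<longlonglongrightarrow> root (2 * j + 1) 0"
    by (rule tendsto_real_root)
  moreover have "root (2 * j + 1) (\<rho> i ^ (2 * j + 1)) = \<rho> i" for i
    using \<rho>_nn by (intro real_root_power_cancel) auto
  ultimately have \<rho>_lim: "\<rho> \<longlonglongrightarrow> 0" by (simp only: real_root_zero)
  have inv_n: "(\<lambda>i. 9 / real (n i)) \<longlonglongrightarrow> 0"
    by (intro tendsto_divide_0[OF tendsto_const] filterlim_compose[OF tendsto_inverse_0] 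
        filterlim_at_top_imp_at_infinity filterlim_compose[OF filterlim_real_sequentially assms(2)])
  have u_lim: "u \<longlonglongrightarrow> 0"
  proof -
    have "u \<longlonglongrightarrow> 4 ^ j * (3 * (0 + 0) + (real (2 * j + 3))\<^sup>2 * (0 + 4 * 0\<^sup>2 + 2 * 0))"
      unfolding u_def by (intro tendsto_intros \<rho>_lim r_lim inv_n)
    then show ?thesis by simp
  qed
  have "\<epsilon> \<longlonglongrightarrow> 0"
  proof (rule real_tendsto_sandwich[OF _ _ tendsto_const u_lim])
    have dn: "real (d i) * real (n i) / 2 > 0" if "n i \<ge> 1" for i using that assms(3)[of i] by simp
    show "eventually (\<lambda>i. 0 \<le> \<epsilon> i) sequentially"
      using n_large[of 1]
    proof eventually_elim
      case (elim i)
      obtain H where H: "subgraph_of H (\<Gamma> i)" "\<not> contains_copy H (cycle_graph (2 * k + 1))"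
        "card (edges (\<Gamma> i)) \<le> 2 * card (edges H)"
        using bipartite_subgraph[OF simple] by blast
      have "real (card (edges (\<Gamma> i))) \<le> 2 * ex i"
        using ex_num_ge[OF simple H(1,2)] H(3) unfolding ex_def by linarith
      then have "1 / 2 * (real (d i) * real (n i) / 2) \<le> ex i" using edges[of i] by simp
      then show ?case using dn[OF elim] by (simp add: \<epsilon>_def pos_le_divide_eq)
    qed
    have "eventually (\<lambda>i. \<rho> i < 1) sequentially" using \<rho>_lim by (rule order_tendstoD) simp
    then show "eventually (\<lambda>i. \<epsilon> i \<le> u i) sequentially"
      using n_large[of 1]
    proof eventually_elim
      case (elim i)
      obtain H0 where "subgraph_of H0 (\<Gamma> i)" "\<not> contains_copy H0 (cycle_graph (2 * k + 1))"
        using bipartite_subgraph[OF simple] by blast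
      then obtain H where H: "subgraph_of H (\<Gamma> i)" "\<not> contains_copy H (cycle_graph (2 * k + 1))"
        "ex_num (\<Gamma> i) (cycle_graph (2 * k + 1)) = card (edges H)"
        using ex_num_attained[OF simple] by blast
      have lam_le: "lam i \<le> real (d i)" using elim assms(3)[of i] by (simp add: \<rho>_def)
      have length_eq: "2 * k + 1 = 2 * j + 3" by (simp add: k)
      have "2 * ex i \<le> real (n i) * real (d i) * (1 / 2 + u i)"
        unfolding ex_def H(3) u_def \<rho>_def r_def
        by (rule subgraph_edge_bound[OF assms(5) _ assms(3,4) lam_le H(1) H(2)[unfolded length_eq]])
          (use elim in simp)
      then have "ex i \<le> (1 / 2 + u i) * (real (d i) * real (n i) / 2)" by (simp add: mult_ac)
      then have "ex i / (real (d i) * real (n i) / 2) \<le> 1 / 2 + u i"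
        using dn[of i] elim by (subst pos_divide_le_eq) auto
      then show ?case unfolding \<epsilon>_def by linarith
    qed
  qed
  \<comment> \<open>For the finitely many $i$ with $n_i = 0$ both sides of the claim are 0.\<close>
  moreover have "ex i = (1 / 2 + \<epsilon> i) * (real (d i) * real (n i) / 2)" for i
  proof (cases "n i = 0")
    case True
    then have no_edges: "card (edges (\<Gamma> i)) = 0" using edges[of i] by simp
    obtain H0 where "subgraph_of H0 (\<Gamma> i)" "\<not> contains_copy H0 (cycle_graph (2 * k + 1))"
      using bipartite_subgraph[OF simple] by blast
    then obtain H where "subgraph_of H (\<Gamma> i)" "ex_num (\<Gamma> i) (cycle_graph (2 * k + 1)) = card (edges H)"
      using ex_num_attained[OF simple] by blast
    then have "ex i \<le> real (card (edges (\<Gamma> i)))"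
      using card_mono[OF finite_edges[OF simple]] by (auto simp: ex_def subgraph_of_def)
    then show ?thesis using no_edges True by (simp add: ex_def)
  next
    case False
    then show ?thesis using assms(3)[of i] by (simp add: \<epsilon>_def)
  qed
  ultimately show ?thesis unfolding ex_def by blast
qed

end
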